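(* Let $\Sigma^2$ be an immersed non-minimal pmc surface in $M^3(c)\times\mathbb{R}$ with mean curvature vector $H$, and let $\phi$ be the traceless part of its second fundamental form. Then $$\frac{1}{2}\Delta|\phi|^2=|\nabla\phi_3|^2+|\nabla\phi_4|^2-|\phi|^4+\{c(2-3|T|^2)+2|H|^2\}|\phi|^2-2c\langle\phi(T,T),H\rangle+2c|\nu_3\phi_3+\nu_4\phi_4|^2,$$ or, equivalently, $$\frac{1}{2}\Delta|\phi|^2=|\nabla\phi_3|^2+|\nabla\phi_4|^2-|\phi|^4+\{c(2-3|T|^2)+2|H|^2\}|\phi|^2-2c\langle\phi(T,T),H\rangle+2c|A_N|^2-4c\langle H,N\rangle^2.$$
   Context: $M^3(c)$ denotes the $3$-dimensional space form of constant sectional curvature $c$ (complete, simply-connected), and $M^3(c)\times\mathbb{R}$ carries the product metric. $\xi$ is the unit (parallel) vector field tangent to the factor $\mathbb{R}$. For an immersed surface $\Sigma^2$ in $M^3(c)\times\mathbb{R}$, $T$ and $N$ are the tangent and normal components of $\xi$ along $\Sigma^2$; $\sigma$ is the second fundamental form; $A_V$ is the shape operator in the normal direction $V$, $\langle A_VX,Y\rangle=\langle\sigma(X,Y),V\rangle$; $H=\frac12\operatorname{trace}\sigma$ is the mean curvature vector. $\Sigma^2$ is a pmc surface if $\nabla^{\perp}H=0$, where $\nabla^\perp$ is the connection in the normal bundle; then $|H|$ is constant, and non-minimal means $H\neq0$. $\{E_3=\frac{H}{|H|},E_4\}$ is a local orthonormal frame field of the normal bundle, $\phi_3=A_{E_3}-|H|\,\mathrm{I}$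 (with $\mathrm I$ the identity), $\phi_4=A_{E_4}$, $\nu_3=\langle\xi,E_3\rangle$, $\nu_4=\langle\xi,E_4\rangle$ (so $N=\nu_3E_3+\nu_4E_4$), and $\phi(X,Y)=\sigma(X,Y)-\langle X,Y\rangle H=\sum_{\alpha=3}^4\langle\phi_\alpha X,Y\rangle E_\alpha$, so $|\phi|^2=|\phi_3|^2+|\phi_4|^2=|\sigma|^2-2|H|^2$. Norms of operators and of their covariant derivatives ($\nabla$ the Levi-Civita connection of $\Sigma^2$) are the standard tensor norms, and $\Delta$ is the Laplacian (trace of the Hessian) on $\Sigma^2$. *)

theory Defs
  imports "HOL-Analysis.Analysis"
begin

section \<open>Smooth maps and abstract smooth surfaces\<close>

primrec Ck_on :: "nat \<Rightarrow> 'a::real_normed_vector set \<Rightarrow> ('a \<Rightarrow> 'b::real_normed_vector) \<Rightarrow> bool" where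
  "Ck_on 0 U F \<longleftrightarrow> continuous_on U F"
| "Ck_on (Suc k) U F \<longleftrightarrow> (\<forall>u\<in>U. F differentiable (at u)) \<and>
     (\<forall>v. Ck_on k U (\<lambda>u. frechet_derivative F (at u) v))"

text \<open>Used for open \<open>U\<close> only.\<close>

definition smooth_on :: "'a::real_normed_vector set \<Rightarrow> ('a \<Rightarrow> 'b::real_normed_vector) \<Rightarrow> bool" where
  "smooth_on U F \<longleftrightarrow> (\<forall>k. Ck_on k U F)"

text \<open>An element \<open>(U, x)\<close> of an atlas is a local parametrization \<open>x : U \<rightarrow> S\<close>,
  that is, the inverse of a chart.\<close>

type_synonym 'a atlas = "((real^2) set \<times> (real^2 \<Rightarrow> 'a)) set"

definition smooth_surface :: "'a topology \<Rightarrow> 'a atlas \<Rightarrow> bool" where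
  "smooth_surface S \<A> \<longleftrightarrow>
     Hausdorff_space S \<and> second_countable S \<and>
     topspace S = (\<Union>(U, x)\<in>\<A>. x ` U) \<and>
     (\<forall>(U, x)\<in>\<A>. open U \<and> openin S (x ` U) \<and>
        homeomorphic_map (top_of_set U) (subtopology S (x ` U)) x) \<and>
     (\<forall>(U, x)\<in>\<A>. \<forall>(V, y)\<in>\<A>. smooth_on {u \<in> U. x u \<in> y ` V} (inv_into V y \<circ> x))"

section \<open>The product of a three-dimensional space form and the real line\<close>

text \<open>
  \<open>M\<^sup>3(c)\<close> is realized as the hypersurface \<open>a\<^sup>2 + c |z|\<^sup>2 = 1\<close> (with \<open>a > 0\<close> if \<open>c \<le> 0\<close>) of
  \<open>\<real> \<times> \<real>\<^sup>3\<close>, with the metric induced by \<open>da\<^sup>2 / c + |dz|\<^sup>2\<close> (by \<open>|dz|\<^sup>2\<close> if \<open>c = 0\<close>).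
  Substituting \<open>a = sqrt |c| b\<close> for \<open>c \<noteq> 0\<close>, this is the round sphere \<open>b\<^sup>2 + |z|\<^sup>2 = 1/c\<close> of
  Euclidean space if \<open>c > 0\<close>, and the sheet \<open>b > 0\<close> of the hyperboloid \<open>- b\<^sup>2 + |z|\<^sup>2 = 1/c\<close> of
  Minkowski space if \<open>c < 0\<close>. If \<open>c = 0\<close> it is the affine subspace \<open>a = 1\<close>, that is, Euclidean space.
  The bilinear form \<open>prod_inner c\<close> is indefinite for \<open>c < 0\<close>, but positive definite on
  the tangent spaces \<open>prod_tangent c p\<close>.
\<close>

definition space_form :: "real \<Rightarrow> (real \<times> (real^3)) set" where
  "space_form c = {(a, z). a\<^sup>2 + c * (z \<bullet> z) = 1 \<and> (c \<le> 0 \<longrightarrow> a > 0)}"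

definition model_inner :: "real \<Rightarrow> real \<times> (real^3) \<Rightarrow> real \<times> (real^3) \<Rightarrow> real" where
  "model_inner c v w = (if c = 0 then 0 else fst v * fst w / c) + snd v \<bullet> snd w"

type_synonym amb = "(real \<times> (real^3)) \<times> real"

definition prod_inner :: "real \<Rightarrow> amb \<Rightarrow> amb \<Rightarrow> real" where
  "prod_inner c v w = model_inner c (fst v) (fst w) + snd v * snd w"

definition prod_norm :: "real \<Rightarrow> amb \<Rightarrow> real" where
  "prod_norm c v = sqrt (prod_inner c v v)"

definition prod_tangent :: "real \<Rightarrow> amb \<Rightarrow> amb set" where
  "prod_tangent c p = {v. fst (fst p) * fst (fst v) + c * (snd (fst p) \<bullet> snd (fst v)) = 0}"

definition xi :: amb where
  "xi = (0, 1)"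

definition partial :: "2 \<Rightarrow> (real^2 \<Rightarrow> 'b::real_normed_vector) \<Rightarrow> real^2 \<Rightarrow> 'b" where
  "partial i F u = frechet_derivative F (at u) (axis i 1)"

text \<open>
  The Levi-Civita connection of \<open>M\<^sup>3(c) \<times> \<real>\<close> along a map \<open>X\<close>, applied to a vector field \<open>V\<close> along \<open>X\<close>
  that is tangent to \<open>M\<^sup>3(c) \<times> \<real>\<close>: the tangential projection of the flat derivative.
  For \<open>c \<noteq> 0\<close> the normal direction of the hypersurface is its position vector \<open>P\<close>, with
  \<open>\<langle>P, P\<rangle> = 1/c\<close>, and \<open>\<langle>\<partial>\<^sub>iV, P\<rangle> = - \<langle>V, \<partial>\<^sub>iP\<rangle>\<close>. For \<open>c = 0\<close> the correction vanishes, as it should.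
\<close>

definition prod_conn :: "real \<Rightarrow> (real^2 \<Rightarrow> amb) \<Rightarrow> 2 \<Rightarrow> (real^2 \<Rightarrow> amb) \<Rightarrow> real^2 \<Rightarrow> amb" where
  "prod_conn c X i V u =
     partial i V u + (c * model_inner c (fst (V u)) (fst (partial i X u))) *\<^sub>R (fst (X u), 0)"

section \<open>Local geometry of a parametrized surface\<close>

text \<open>
  Here \<open>X : U \<rightarrow> M\<^sup>3(c) \<times> \<real>\<close> is an immersion of an open set \<open>U \<subseteq> \<real>\<^sup>2\<close>.
  A tangent vector of the surface is given by its components in the coordinate
  frame \<open>\<partial>\<^sub>1X, \<partial>\<^sub>2X\<close>, and an endomorphism \<open>B\<close> of the tangent space by its matrix, so that
  \<open>B $ i $ j\<close> is the mixed component \<open>B\<^sup>i\<^sub>j\<close>.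
\<close>

definition metric :: "real \<Rightarrow> (real^2 \<Rightarrow> amb) \<Rightarrow> real^2 \<Rightarrow> real^2^2" where
  "metric c X u = (\<chi> i j. prod_inner c (partial i X u) (partial j X u))"

definition metric_inv :: "real \<Rightarrow> (real^2 \<Rightarrow> amb) \<Rightarrow> real^2 \<Rightarrow> real^2^2" where
  "metric_inv c X u = matrix_inv (metric c X u)"

definition tan_coords :: "real \<Rightarrow> (real^2 \<Rightarrow> amb) \<Rightarrow> real^2 \<Rightarrow> amb \<Rightarrow> real^2" where
  "tan_coords c X u w = metric_inv c X u *v (\<chi> j. prod_inner c w (partial j X u))"

definition tan_part :: "real \<Rightarrow> (real^2 \<Rightarrow> amb) \<Rightarrow> real^2 \<Rightarrow> amb \<Rightarrow> amb" where
  "tan_part c X u w = (\<Sum>i\<in>UNIV. tan_coords c X u w $ i *\<^sub>R partial i X u)"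

definition nor_part :: "real \<Rightarrow> (real^2 \<Rightarrow> amb) \<Rightarrow> real^2 \<Rightarrow> amb \<Rightarrow> amb" where
  "nor_part c X u w = w - tan_part c X u w"

definition second_form :: "real \<Rightarrow> (real^2 \<Rightarrow> amb) \<Rightarrow> 2 \<Rightarrow> 2 \<Rightarrow> real^2 \<Rightarrow> amb" where
  "second_form c X i j u = nor_part c X u (prod_conn c X i (partial j X) u)"

definition mean_curvature :: "real \<Rightarrow> (real^2 \<Rightarrow> amb) \<Rightarrow> real^2 \<Rightarrow> amb" where
  "mean_curvature c X u =
     (1/2) *\<^sub>R (\<Sum>i\<in>UNIV. \<Sum>j\<in>UNIV. metric_inv c X u $ i $ j *\<^sub>R second_form c X i j u)"

definition normal_conn :: "real \<Rightarrow> (real^2 \<Rightarrow> amb) \<Rightarrow> 2 \<Rightarrow> (real^2 \<Rightarrow> amb) \<Rightarrow> real^2 \<Rightarrow> amb" where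
  "normal_conn c X i V u = nor_part c X u (prod_conn c X i V u)"

text \<open>The shape operator: \<open>\<langle>A\<^sub>V \<partial>\<^sub>j, \<partial>\<^sub>k\<rangle> = \<langle>\<sigma>(\<partial>\<^sub>j, \<partial>\<^sub>k), V\<rangle>\<close> with the index \<open>k\<close> raised.\<close>

definition shape_op :: "real \<Rightarrow> (real^2 \<Rightarrow> amb) \<Rightarrow> real^2 \<Rightarrow> amb \<Rightarrow> real^2^2" where
  "shape_op c X u v = metric_inv c X u ** (\<chi> k j. prod_inner c (second_form c X j k u) v)"

text \<open>The components of \<open>\<phi>(X, Y) = \<sigma>(X, Y) - \<langle>X, Y\<rangle>H\<close> and the squared norm of this tensor.\<close>

definition phi_form :: "real \<Rightarrow> (real^2 \<Rightarrow> amb) \<Rightarrow> 2 \<Rightarrow> 2 \<Rightarrow> real^2 \<Rightarrow> amb" where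
  "phi_form c X i j u = second_form c X i j u - metric c X u $ i $ j *\<^sub>R mean_curvature c X u"

definition phi_norm_sq :: "real \<Rightarrow> (real^2 \<Rightarrow> amb) \<Rightarrow> real^2 \<Rightarrow> real" where
  "phi_norm_sq c X u = (\<Sum>i\<in>UNIV. \<Sum>j\<in>UNIV. \<Sum>k\<in>UNIV. \<Sum>l\<in>UNIV.
     metric_inv c X u $ i $ k * metric_inv c X u $ j $ l *
     prod_inner c (phi_form c X i j u) (phi_form c X k l u))"

definition E3 :: "real \<Rightarrow> (real^2 \<Rightarrow> amb) \<Rightarrow> real^2 \<Rightarrow> amb" where
  "E3 c X u = mean_curvature c X u /\<^sub>R prod_norm c (mean_curvature c X u)"

definition phi3 :: "real \<Rightarrow> (real^2 \<Rightarrow> amb) \<Rightarrow> real^2 \<Rightarrow> real^2^2" where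
  "phi3 c X u = shape_op c X u (E3 c X u) - prod_norm c (mean_curvature c X u) *\<^sub>R mat 1"

definition phi4 :: "real \<Rightarrow> (real^2 \<Rightarrow> amb) \<Rightarrow> (real^2 \<Rightarrow> amb) \<Rightarrow> real^2 \<Rightarrow> real^2^2" where
  "phi4 c X E4 u = shape_op c X u (E4 u)"

definition orthonormal_normal_frame ::
    "real \<Rightarrow> (real^2 \<Rightarrow> amb) \<Rightarrow> (real^2) set \<Rightarrow> (real^2 \<Rightarrow> amb) \<Rightarrow> (real^2 \<Rightarrow> amb) \<Rightarrow> bool" where
  "orthonormal_normal_frame c X V F G \<longleftrightarrow> smooth_on V F \<and> smooth_on V G \<and>
     (\<forall>u\<in>V. F u \<in> prod_tangent c (X u) \<and> G u \<in> prod_tangent c (X u) \<and>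
        (\<forall>i. prod_inner c (F u) (partial i X u) = 0 \<and> prod_inner c (G u) (partial i X u) = 0) \<and>
        prod_inner c (F u) (F u) = 1 \<and> prod_inner c (G u) (G u) = 1 \<and>
        prod_inner c (F u) (G u) = 0)"

subsection \<open>Levi-Civita connection, tensor norms and Laplacian of the induced metric\<close>

definition christoffel :: "real \<Rightarrow> (real^2 \<Rightarrow> amb) \<Rightarrow> 2 \<Rightarrow> 2 \<Rightarrow> 2 \<Rightarrow> real^2 \<Rightarrow> real" where
  "christoffel c X k i j u = (1/2) * (\<Sum>m\<in>UNIV. metric_inv c X u $ k $ m *
     (partial i (\<lambda>v. metric c X v $ j $ m) u + partial j (\<lambda>v. metric c X v $ i $ m) u
        - partial m (\<lambda>v. metric c X v $ i $ j) u))"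

definition op_inner :: "real \<Rightarrow> (real^2 \<Rightarrow> amb) \<Rightarrow> real^2 \<Rightarrow> real^2^2 \<Rightarrow> real^2^2 \<Rightarrow> real" where
  "op_inner c X u B C = (\<Sum>i\<in>UNIV. \<Sum>j\<in>UNIV. \<Sum>k\<in>UNIV. \<Sum>l\<in>UNIV.
     metric c X u $ i $ k * metric_inv c X u $ j $ l * B $ i $ j * C $ k $ l)"

definition op_norm_sq :: "real \<Rightarrow> (real^2 \<Rightarrow> amb) \<Rightarrow> real^2 \<Rightarrow> real^2^2 \<Rightarrow> real" where
  "op_norm_sq c X u B = op_inner c X u B B"

definition nabla_op :: "real \<Rightarrow> (real^2 \<Rightarrow> amb) \<Rightarrow> 2 \<Rightarrow> (real^2 \<Rightarrow> real^2^2) \<Rightarrow> real^2 \<Rightarrow> real^2^2" where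
  "nabla_op c X k B u = (\<chi> i j. partial k (\<lambda>v. B v $ i $ j) u
     + (\<Sum>l\<in>UNIV. christoffel c X i k l u * B u $ l $ j)
     - (\<Sum>l\<in>UNIV. christoffel c X l k j u * B u $ i $ l))"

definition nabla_norm_sq :: "real \<Rightarrow> (real^2 \<Rightarrow> amb) \<Rightarrow> (real^2 \<Rightarrow> real^2^2) \<Rightarrow> real^2 \<Rightarrow> real" where
  "nabla_norm_sq c X B u = (\<Sum>k\<in>UNIV. \<Sum>l\<in>UNIV.
     metric_inv c X u $ k $ l * op_inner c X u (nabla_op c X k B u) (nabla_op c X l B u))"

definition laplacian :: "real \<Rightarrow> (real^2 \<Rightarrow> amb) \<Rightarrow> (real^2 \<Rightarrow> real) \<Rightarrow> real^2 \<Rightarrow> real" where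
  "laplacian c X h u = (\<Sum>i\<in>UNIV. \<Sum>j\<in>UNIV. metric_inv c X u $ i $ j *
     (partial i (partial j h) u - (\<Sum>k\<in>UNIV. christoffel c X k i j u * partial k h u)))"

section \<open>Immersed surfaces with parallel mean curvature vector\<close>

definition immersed_surface :: "real \<Rightarrow> 'a topology \<Rightarrow> 'a atlas \<Rightarrow> ('a \<Rightarrow> amb) \<Rightarrow> bool" where
  "immersed_surface c S \<A> f \<longleftrightarrow> smooth_surface S \<A> \<and>
     (\<forall>p\<in>topspace S. f p \<in> space_form c \<times> UNIV) \<and>
     (\<forall>(U, x)\<in>\<A>. smooth_on U (f \<circ> x) \<and> (\<forall>u\<in>U. inj (frechet_derivative (f \<circ> x) (at u))))"

definition pmc :: "real \<Rightarrow> 'a atlas \<Rightarrow> ('a \<Rightarrow> amb) \<Rightarrow> bool" where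
  "pmc c \<A> f \<longleftrightarrow> (\<forall>(U, x)\<in>\<A>. \<forall>u\<in>U. \<forall>i.
     normal_conn c (f \<circ> x) i (mean_curvature c (f \<circ> x)) u = 0)"

text \<open>Since \<open>|H|\<close> is constant on a (connected) pmc surface, non-minimality means that \<open>H\<close> has no zero.\<close>

definition non_minimal :: "real \<Rightarrow> 'a atlas \<Rightarrow> ('a \<Rightarrow> amb) \<Rightarrow> bool" where
  "non_minimal c \<A> f \<longleftrightarrow> (\<forall>(U, x)\<in>\<A>. \<forall>u\<in>U. mean_curvature c (f \<circ> x) u \<noteq> 0)"

end

theory Submission
  imports Defs
begin

text \<open>
  Since \<open>H\<close> is parallel and the normal bundle has rank two, \<open>E\<^sub>3\<close> and \<open>E\<^sub>4\<close> are both parallel. For each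
  of them the Codazzi equation reads \<open>d\<^sup>\<nabla> \<phi>\<^sub>\<alpha> = c \<nu>\<^sub>\<alpha> T\<close>, and since \<open>\<phi>\<^sub>\<alpha>\<close> is traceless and symmetric on a surface,
  also \<open>div \<phi>\<^sub>\<alpha> = c \<nu>\<^sub>\<alpha> T\<close>. The Weitzenboeck formula on a surface of curvature \<open>K\<close> then gives
  \<open>1/2 \<Delta>|\<phi>\<^sub>\<alpha>|\<^sup>2 = |\<nabla>\<phi>\<^sub>\<alpha>|\<^sup>2 + 2 K |\<phi>\<^sub>\<alpha>|\<^sup>2 + 2 c \<langle>\<nabla>(\<nu>\<^sub>\<alpha> T), \<phi>\<^sub>\<alpha>\<rangle>\<close>.
  One inserts the Gauss equation \<open>K = c (1 - |T|\<^sup>2) + |H|\<^sup>2 - |\<phi>|\<^sup>2 / 2\<close>, and \<open>\<nabla>T = A\<^sub>N\<close>,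
  \<open>d\<nu>\<^sub>\<alpha> = - \<langle>A\<^sub>\<alpha> T, \<cdot>\<rangle>\<close>, which hold because \<open>\<xi>\<close> is parallel.
  All of this is computed in an orthonormal frame obtained from the coordinates by Gram-Schmidt.
\<close>

section \<open>Calculus of smooth maps\<close>

text \<open>The coefficient 3 of \<open>|T|^2\<close> has two sources. The curvature term
  contributes \<open>-2 c |T|^2 |phi|^2\<close>, together with the quartic term. The derivative of
  \<open>\<nu> \<alpha>\<close> contributes \<open>-2 c <A_\<alpha> T, phi_\<alpha> T>\<close>. A
  traceless symmetric operator on a plane squares to half its squared norm times the identity, so
  the traceless part of \<open>A_\<alpha>\<close> gives the remaining
  \<open>-c |T|^2 |phi|^2\<close>, and its trace part gives the term in
  \<open><phi(T,T), H>\<close>. What is left pairs \<open>A_N\<close> with the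
  \<open>phi_\<alpha>\<close> and so sees only the traceless part of \<open>A_N\<close>, which is
  \<open>nu_3 phi_3 + nu_4 phi_4\<close>. The statement lives in coordinates, with Christoffel
  symbols and inverse metrics, whereas in a frame every identity is polynomial in a few scalar
  functions. Hence the tangent frame is a pair of vector fields on the parameter plane, derivatives
  are flat derivatives in \<open>amb\<close>, and each term of the statement is translated
  separately. The form \<open>prod_inner c\<close> degenerates on \<open>amb\<close> for
  \<open>c = 0\<close>; inner products with the position vector therefore carry a factor
  \<open>c\<close>, which treats all curvatures at once.\<close>

lemma frechet_derivative_cong_open:
  assumes "open U" and "u \<in> U" and "\<And>p. p \<in> U \<Longrightarrow> F p = G p"
  shows "frechet_derivative F (at u) = frechet_derivative G (at u)"
    and "F differentiable (at u) \<longleftrightarrow> G differentiable (at u)"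
proof -
  have "(F has_derivative D) (at u) \<longleftrightarrow> (G has_derivative D) (at u)" for D
    using has_derivative_transform_within_open[OF _ assms(1,2)] assms(3) by metis
  then show "frechet_derivative F (at u) = frechet_derivative G (at u)"
    and "F differentiable (at u) \<longleftrightarrow> G differentiable (at u)"
    by (simp_all add: frechet_derivative_def differentiable_def)
qed

lemma Ck_on_cong:
  assumes "open U" and "\<And>u. u \<in> U \<Longrightarrow> F u = G u"
  shows "Ck_on k U F \<longleftrightarrow> Ck_on k U G"
  using assms(2)
proof (induction k arbitrary: F G)
  case 0
  then show ?case by (simp cong: continuous_on_cong)
next
  case (Suc k)
  have "Ck_on k U (\<lambda>u. frechet_derivative F (at u) v) \<longleftrightarrow> Ck_on k U (\<lambda>u. frechet_derivative G (at u) v)" for v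
    using frechet_derivative_cong_open(1)[OF assms(1) _ Suc.prems] by (intro Suc.IH) simp
  then show ?case
    using frechet_derivative_cong_open(2)[OF assms(1) _ Suc.prems] by simp
qed

lemma smooth_on_cong:
  assumes "open U" and "\<And>u. u \<in> U \<Longrightarrow> F u = G u"
  shows "smooth_on U F \<longleftrightarrow> smooth_on U G"
  using Ck_on_cong[OF assms] by (simp add: smooth_on_def)

lemma Ck_on_SucD: "Ck_on (Suc k) U F \<Longrightarrow> Ck_on k U F"
proof (induction k arbitrary: F)
  case 0
  then show ?case
    by (auto intro!: continuous_at_imp_continuous_on differentiable_imp_continuous_within)
next
  case (Suc k)
  then show ?case by (metis Ck_on.simps(2))
qed

lemma Ck_on_subset: "Ck_on k U F \<Longrightarrow> V \<subseteq> U \<Longrightarrow> Ck_on k V F"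
  by (induction k arbitrary: F) (auto intro: continuous_on_subset)

lemma smooth_on_subset: "smooth_on U F \<Longrightarrow> V \<subseteq> U \<Longrightarrow> smooth_on V F"
  by (auto simp: smooth_on_def intro: Ck_on_subset)

lemma smooth_on_differentiable: "smooth_on U F \<Longrightarrow> u \<in> U \<Longrightarrow> F differentiable (at u)"
  unfolding smooth_on_def by (metis Ck_on.simps(2))

lemma smooth_on_continuous: "smooth_on U F \<Longrightarrow> continuous_on U F"
  unfolding smooth_on_def by (metis Ck_on.simps(1))

lemma smooth_on_frechet_derivative:
  "smooth_on U F \<Longrightarrow> smooth_on U (\<lambda>u. frechet_derivative F (at u) v)"
  unfolding smooth_on_def by (metis Ck_on.simps(2))

lemma frechet_derivative_eqI:
  "(F has_derivative D) (at u) \<Longrightarrow> frechet_derivative F (at u) = D"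
  using frechet_derivative_at by metis

text \<open>\<open>frechet_derivative\<close> is a choice operator; this rule lets the closure
  proofs supply whatever derivative the calculus rules produce.\<close>

lemma Ck_on_SucI:
  assumes "open U"
    and "\<And>u. u \<in> U \<Longrightarrow> (F has_derivative D u) (at u)"
    and "\<And>v. Ck_on k U (\<lambda>u. D u v)"
  shows "Ck_on (Suc k) U F"
proof -
  have "frechet_derivative F (at u) = D u" if "u \<in> U" for u
    using assms(2)[OF that] by (rule frechet_derivative_eqI)
  then have "Ck_on k U (\<lambda>u. frechet_derivative F (at u) v)" for v
    using Ck_on_cong[OF assms(1), of "\<lambda>u. frechet_derivative F (at u) v" "\<lambda>u. D u v"] assms(3)
    by simp
  then show ?thesis using assms(2) by (auto simp: differentiable_def)
qed

lemma Ck_on_SucE: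
  assumes "Ck_on (Suc k) U F"
  shows "u \<in> U \<Longrightarrow> (F has_derivative frechet_derivative F (at u)) (at u)"
    and "Ck_on k U (\<lambda>u. frechet_derivative F (at u) v)" and "Ck_on k U F"
  using assms Ck_on_SucD[OF assms] frechet_derivative_works by auto

section \<open>Closure of smooth maps under linear, bilinear and algebraic operations\<close>

lemma Ck_on_const: "Ck_on k U (\<lambda>u. a)"
  by (induction k arbitrary: a) (auto simp: frechet_derivative_const)

lemma Ck_on_linear:
  assumes "open U" and "bounded_linear L"
  shows "Ck_on k U F \<Longrightarrow> Ck_on k U (\<lambda>u. L (F u))"
proof (induction k arbitrary: F)
  case 0
  then show ?case using assms(2) by (simp add: bounded_linear.continuous_on)
next
  case (Suc k)
  show ?case
    by (rule Ck_on_SucI[OF assms(1) bounded_linear.has_derivative[OF assms(2) Ck_on_SucE(1)[OF Suc.prems]]])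
      (use Suc.IH Ck_on_SucE(2)[OF Suc.prems] in auto)
qed

lemma Ck_on_add:
  assumes "open U"
  shows "Ck_on k U F \<Longrightarrow> Ck_on k U G \<Longrightarrow> Ck_on k U (\<lambda>u. F u + G u)"
proof (induction k arbitrary: F G)
  case 0
  then show ?case by (simp add: continuous_on_add)
next
  case (Suc k)
  show ?case
    by (rule Ck_on_SucI[OF assms(1) has_derivative_add[OF Ck_on_SucE(1)[OF Suc.prems(1)] Ck_on_SucE(1)[OF Suc.prems(2)]]])
      (use Suc.IH Ck_on_SucE(2)[OF Suc.prems(1)] Ck_on_SucE(2)[OF Suc.prems(2)] in auto)
qed

text \<open>The Leibniz rule writes the derivative as a sum of values of \<open>B\<close> on maps of
  class \<open>k\<close>, so one induction covers products, scalings and the metric.\<close>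

lemma Ck_on_bilinear:
  assumes "open U" and "bounded_bilinear B"
  shows "Ck_on k U F \<Longrightarrow> Ck_on k U G \<Longrightarrow> Ck_on k U (\<lambda>u. B (F u) (G u))"
proof (induction k arbitrary: F G)
  case 0
  then show ?case using assms(2) by (simp add: bounded_bilinear.continuous_on)
next
  case (Suc k)
  have "Ck_on k U (\<lambda>u. B (F u) (frechet_derivative G (at u) v) + B (frechet_derivative F (at u) v) (G u))" for v
    by (intro Ck_on_add[OF assms(1)] Suc.IH Ck_on_SucE(2,3)[OF Suc.prems(1)]
        Ck_on_SucE(2,3)[OF Suc.prems(2)])
  then show ?case
    by (intro Ck_on_SucI[OF assms(1) bounded_bilinear.FDERIV[OF assms(2) Ck_on_SucE(1)[OF Suc.prems(1)] Ck_on_SucE(1)[OF Suc.prems(2)]]])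
qed

text \<open>The derivative of the reciprocal contains the reciprocal itself, with one order of
  smoothness less to be shown; the induction hypothesis supplies it.\<close>

lemma Ck_on_inverse:
  fixes F :: "'a::real_normed_vector \<Rightarrow> real"
  assumes "open U" and "\<And>u. u \<in> U \<Longrightarrow> F u \<noteq> 0"
  shows "Ck_on k U F \<Longrightarrow> Ck_on k U (\<lambda>u. inverse (F u))"
proof (induction k)
  case 0
  then show ?case using assms(2) by (auto intro!: continuous_on_inverse)
next
  case (Suc k)
  have mult: "Ck_on k U G \<Longrightarrow> Ck_on k U G' \<Longrightarrow> Ck_on k U (\<lambda>u. G u * G' u)"
    for G G' :: "'a \<Rightarrow> real"
    using Ck_on_bilinear[OF assms(1) bounded_bilinear_mult] .
  have neg: "Ck_on k U G \<Longrightarrow> Ck_on k U (\<lambda>u. - G u)" for G :: "'a \<Rightarrow> real"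
    using Ck_on_linear[OF assms(1) bounded_linear_minus[OF bounded_linear_ident]] .
  show ?case
    by (rule Ck_on_SucI[OF assms(1) Deriv.has_derivative_inverse[OF assms(2) Ck_on_SucE(1)[OF Suc.prems]]])
      (use Ck_on_SucE(2,3)[OF Suc.prems] Suc.IH in \<open>auto intro!: mult neg\<close>)
qed

lemma Ck_on_sqrt:
  fixes F :: "'a::real_normed_vector \<Rightarrow> real"
  assumes "open U" and "\<And>u. u \<in> U \<Longrightarrow> F u > 0"
  shows "Ck_on k U F \<Longrightarrow> Ck_on k U (\<lambda>u. sqrt (F u))"
proof (induction k)
  case 0
  then show ?case by (auto intro!: continuous_on_real_sqrt)
next
  case (Suc k)
  have der: "((\<lambda>u. sqrt (F u)) has_derivative
      (\<lambda>v. frechet_derivative F (at u) v * (inverse (sqrt (F u)) / 2))) (at u)" if "u \<in> U" for u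
    using has_derivative_real_sqrt[OF assms(2)[OF that] Ck_on_SucE(1)[OF Suc.prems that]]
    by (rule has_derivative_eq_rhs) (auto simp: field_simps)
  have "Ck_on k U (\<lambda>u. inverse (sqrt (F u)))"
    using assms Suc.IH Ck_on_SucE(3)[OF Suc.prems]
    by (intro Ck_on_inverse) force+
  then have "Ck_on k U (\<lambda>u. inverse (sqrt (F u)) / 2)"
    using Ck_on_linear[OF assms(1) bounded_linear_divide] by blast
  then show ?case
    by (intro Ck_on_SucI[OF assms(1) der] Ck_on_bilinear[OF assms(1) bounded_bilinear_mult]
        Ck_on_SucE(2)[OF Suc.prems])
qed

lemma smooth_on_const: "smooth_on U (\<lambda>u. a)"
  by (simp add: smooth_on_def Ck_on_const)

lemma smooth_on_linear: "open U \<Longrightarrow> bounded_linear L \<Longrightarrow> smooth_on U F \<Longrightarrow> smooth_on U (\<lambda>u. L (F u))"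
  by (simp add: smooth_on_def Ck_on_linear)

lemma smooth_on_add:
  "open U \<Longrightarrow> smooth_on U F \<Longrightarrow> smooth_on U G \<Longrightarrow> smooth_on U (\<lambda>u. F u + G u)"
  by (simp add: smooth_on_def Ck_on_add)

lemma smooth_on_uminus: "open U \<Longrightarrow> smooth_on U F \<Longrightarrow> smooth_on U (\<lambda>u. - F u)"
  by (rule smooth_on_linear[OF _ bounded_linear_minus[OF bounded_linear_ident]])

lemma smooth_on_diff:
  "open U \<Longrightarrow> smooth_on U F \<Longrightarrow> smooth_on U G \<Longrightarrow> smooth_on U (\<lambda>u. F u - G u)"
  using smooth_on_add[of U F "\<lambda>u. - G u"] smooth_on_uminus[of U G] by simp

lemma smooth_on_bilinear:
  "open U \<Longrightarrow> bounded_bilinear B \<Longrightarrow> smooth_on U F \<Longrightarrow> smooth_on U G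
    \<Longrightarrow> smooth_on U (\<lambda>u. B (F u) (G u))"
  by (simp add: smooth_on_def Ck_on_bilinear)

lemma smooth_on_mult:
  fixes F G :: "'a::real_normed_vector \<Rightarrow> real"
  shows "open U \<Longrightarrow> smooth_on U F \<Longrightarrow> smooth_on U G \<Longrightarrow> smooth_on U (\<lambda>u. F u * G u)"
  by (rule smooth_on_bilinear[OF _ bounded_bilinear_mult])

lemma smooth_on_scaleR:
  "open U \<Longrightarrow> smooth_on U f \<Longrightarrow> smooth_on U F \<Longrightarrow> smooth_on U (\<lambda>u. f u *\<^sub>R F u)"
  by (rule smooth_on_bilinear[OF _ bounded_bilinear_scaleR])

lemma smooth_on_power2:
  fixes F :: "'a::real_normed_vector \<Rightarrow> real"
  shows "open U \<Longrightarrow> smooth_on U F \<Longrightarrow> smooth_on U (\<lambda>u. (F u)\<^sup>2)"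
  by (simp add: power2_eq_square smooth_on_mult)

lemma smooth_on_inverse:
  fixes F :: "'a::real_normed_vector \<Rightarrow> real"
  shows "open U \<Longrightarrow> smooth_on U F \<Longrightarrow> (\<And>u. u \<in> U \<Longrightarrow> F u \<noteq> 0) \<Longrightarrow> smooth_on U (\<lambda>u. inverse (F u))"
  by (simp add: smooth_on_def Ck_on_inverse)

lemma smooth_on_sqrt:
  fixes F :: "'a::real_normed_vector \<Rightarrow> real"
  shows "open U \<Longrightarrow> smooth_on U F \<Longrightarrow> (\<And>u. u \<in> U \<Longrightarrow> F u > 0) \<Longrightarrow> smooth_on U (\<lambda>u. sqrt (F u))"
  by (simp add: smooth_on_def Ck_on_sqrt)

lemma smooth_on_sum:
  assumes "open U" and "\<And>i. i \<in> I \<Longrightarrow> smooth_on U (F i)"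
  shows "smooth_on U (\<lambda>u. \<Sum>i\<in>I. F i u)"
  using assms(2)
  by (induction I rule: infinite_finite_induct) (auto intro: smooth_on_const smooth_on_add[OF assms(1)])

section \<open>Symmetry of second derivatives\<close>

lemma has_real_derivative_along_line:
  fixes f :: "'a::real_normed_vector \<Rightarrow> real"
  assumes "f differentiable (at (p + s *\<^sub>R v))"
  shows "((\<lambda>s. f (p + s *\<^sub>R v)) has_real_derivative frechet_derivative f (at (p + s *\<^sub>R v)) v) (at s)"
proof -
  let ?D = "frechet_derivative f (at (p + s *\<^sub>R v))"
  have 1: "(f has_derivative ?D) (at (p + s *\<^sub>R v))"
    using assms frechet_derivative_works by blast
  have "((\<lambda>s. p + s *\<^sub>R v) has_derivative (\<lambda>t. t *\<^sub>R v)) (at s)"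
    by (auto intro!: derivative_eq_intros)
  from has_derivative_compose[OF this 1]
  have "((\<lambda>s. f (p + s *\<^sub>R v)) has_derivative (\<lambda>t. ?D (t *\<^sub>R v))) (at s)" .
  moreover have "?D (t *\<^sub>R v) = ?D v * t" for t
    using linear_frechet_derivative[OF assms] by (simp add: linear_cmul)
  ultimately show ?thesis by (simp add: has_field_derivative_def)
qed

text \<open>The second difference is the increment along \<open>v\<close> of the increment along
  \<open>w\<close>. The mean value theorem, applied in each direction in turn, produces a mixed
  derivative at some point of the parallelogram.\<close>

lemma second_difference_mvt:
  fixes f :: "'a::real_normed_vector \<Rightarrow> real"
  assumes sm: "smooth_on U f" and "h > 0"
    and sub: "\<And>s t. 0 \<le> s \<Longrightarrow> s \<le> h \<Longrightarrow> 0 \<le> t \<Longrightarrow> t \<le> h \<Longrightarrow> u + s *\<^sub>R v + t *\<^sub>R w \<in> U"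
  obtains s t where "0 \<le> s" "s \<le> h" "0 \<le> t" "t \<le> h"
    "f (u + h *\<^sub>R v + h *\<^sub>R w) - f (u + h *\<^sub>R v) - f (u + h *\<^sub>R w) + f u =
     h\<^sup>2 * frechet_derivative (\<lambda>p. frechet_derivative f (at p) v) (at (u + s *\<^sub>R v + t *\<^sub>R w)) w"
proof -
  let ?g = "\<lambda>p. frechet_derivative f (at p) v"
  let ?\<phi> = "\<lambda>s. f ((u + h *\<^sub>R w) + s *\<^sub>R v) - f (u + s *\<^sub>R v)"
  have d1: "(?\<phi> has_real_derivative ?g ((u + h *\<^sub>R w) + s *\<^sub>R v) - ?g (u + s *\<^sub>R v)) (at s)"
    if "0 \<le> s" "s \<le> h" for s
    using sub[of s h] sub[of s 0] that \<open>h > 0\<close>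
    by (intro DERIV_diff has_real_derivative_along_line smooth_on_differentiable[OF sm])
      (auto simp: algebra_simps)
  from MVT2[OF \<open>h > 0\<close>, of ?\<phi>, OF d1] obtain s where s: "0 < s" "s < h"
    "?\<phi> h - ?\<phi> 0 = h * (?g ((u + h *\<^sub>R w) + s *\<^sub>R v) - ?g (u + s *\<^sub>R v))"
    by auto
  have d2: "((\<lambda>t. ?g ((u + s *\<^sub>R v) + t *\<^sub>R w)) has_real_derivative
      frechet_derivative ?g (at ((u + s *\<^sub>R v) + t *\<^sub>R w)) w) (at t)"
    if "0 \<le> t" "t \<le> h" for t
    using sub[of s t] that s
    by (intro has_real_derivative_along_line smooth_on_differentiable[OF smooth_on_frechet_derivative[OF sm]])
      auto
  from MVT2[OF \<open>h > 0\<close>, of "\<lambda>t. ?g ((u + s *\<^sub>R v) + t *\<^sub>R w)", OF d2] obtain t where t: "0 < t" "t < h"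
    "?g ((u + s *\<^sub>R v) + h *\<^sub>R w) - ?g (u + s *\<^sub>R v) =
      h * frechet_derivative ?g (at ((u + s *\<^sub>R v) + t *\<^sub>R w)) w"
    by auto
  have "(u + h *\<^sub>R w) + s *\<^sub>R v = (u + s *\<^sub>R v) + h *\<^sub>R w" "(u + h *\<^sub>R w) + h *\<^sub>R v = u + h *\<^sub>R v + h *\<^sub>R w"
    by (simp_all add: algebra_simps)
  with s t show thesis
    by (intro that[of s t]) (auto simp: power2_eq_square)
qed

text \<open>Exchanging \<open>v\<close> and \<open>w\<close> leaves the second difference unchanged,
  so the two mixed derivatives share a value, though at two different points near \<open>u\<close>;
  continuity then makes them agree at \<open>u\<close>.\<close>

lemma second_derivative_symmetric_real:
  fixes f :: "'a::real_normed_vector \<Rightarrow> real"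
  assumes "open U" and sm: "smooth_on U f" and "u \<in> U"
  shows "frechet_derivative (\<lambda>p. frechet_derivative f (at p) v) (at u) w =
         frechet_derivative (\<lambda>p. frechet_derivative f (at p) w) (at u) v"
proof (rule ccontr)
  define F where "F v w p = frechet_derivative (\<lambda>p. frechet_derivative f (at p) v) (at p) w" for v w p
  assume "\<not> ?thesis"
  then have ne: "F v w u \<noteq> F w v u" by (simp add: F_def)
  have cont: "isCont (F v w) u" for v w
    unfolding F_def using assms
    by (intro continuous_on_interior[OF smooth_on_continuous[OF smooth_on_frechet_derivative[OF smooth_on_frechet_derivative[OF sm]]]])
      (simp add: interior_open)
  \<comment> \<open>Half the gap: one number cannot be closer than this to both values.\<close>
  define \<epsilon> where "\<epsilon> = \<bar>F v w u - F w v u\<bar> / 2"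
  have "\<epsilon> > 0" using ne by (simp add: \<epsilon>_def)
  obtain d1 where d1: "d1 > 0" "\<And>p. dist p u < d1 \<Longrightarrow> \<bar>F v w p - F v w u\<bar> < \<epsilon>"
    using cont[of v w] \<open>\<epsilon> > 0\<close> unfolding continuous_at_eps_delta dist_real_def by blast
  obtain d2 where d2: "d2 > 0" "\<And>p. dist p u < d2 \<Longrightarrow> \<bar>F w v p - F w v u\<bar> < \<epsilon>"
    using cont[of w v] \<open>\<epsilon> > 0\<close> unfolding continuous_at_eps_delta dist_real_def by blast
  obtain d3 where d3: "d3 > 0" "ball u d3 \<subseteq> U"
    using assms open_contains_ball by metis
  define d where "d = min d1 (min d2 d3)"
  have "d > 0" using d1 d2 d3 by (simp add: d_def)
  \<comment> \<open>Keeps the whole parallelogram with sides \<open>h v\<close> and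
    \<open>h w\<close> within distance \<open>d\<close> of \<open>u\<close>; the summand 1 makes the
    denominator positive even if both vectors vanish.\<close>
  define h where "h = d / (2 * (norm v + norm w + 1))"
  have n: "norm v + norm w + 1 > 0" by (simp add: add_nonneg_pos)
  have "h > 0" using \<open>d > 0\<close> n by (simp add: h_def)
  have near: "dist (u + s *\<^sub>R a + t *\<^sub>R b) u < d"
    if "0 \<le> s" "s \<le> h" "0 \<le> t" "t \<le> h" "norm a + norm b = norm v + norm w" for s t a b
  proof -
    have "dist (u + s *\<^sub>R a + t *\<^sub>R b) u = norm (s *\<^sub>R a + t *\<^sub>R b)"
      by (simp add: dist_norm)
    also have "\<dots> \<le> s * norm a + t * norm b"
      using norm_triangle_ineq[of "s *\<^sub>R a" "t *\<^sub>R b"] that by simp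
    also have "\<dots> \<le> h * norm a + h * norm b"
      using that by (intro add_mono mult_right_mono) auto
    also have "\<dots> = h * (norm v + norm w)" using that by (simp flip: distrib_left)
    also have "\<dots> < h * (2 * (norm v + norm w + 1))"
      using \<open>h > 0\<close> n by (intro mult_strict_left_mono) (auto simp: add_nonneg_pos)
    also have "\<dots> = d" using n by (simp add: h_def)
    finally show ?thesis .
  qed
  have sub: "u + s *\<^sub>R a + t *\<^sub>R b \<in> U"
    if "0 \<le> s" "s \<le> h" "0 \<le> t" "t \<le> h" "norm a + norm b = norm v + norm w" for s t a b
    using near[OF that] d3(2) by (auto simp: d_def dist_commute mem_ball)
  let ?S = "f (u + h *\<^sub>R v + h *\<^sub>R w) - f (u + h *\<^sub>R v) - f (u + h *\<^sub>R w) + f u"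
  obtain s t where st: "0 \<le> s" "s \<le> h" "0 \<le> t" "t \<le> h" "?S = h\<^sup>2 * F v w (u + s *\<^sub>R v + t *\<^sub>R w)"
    using second_difference_mvt[OF sm \<open>h > 0\<close>, of u v w] sub unfolding F_def by metis
  obtain s' t' where st': "0 \<le> s'" "s' \<le> h" "0 \<le> t'" "t' \<le> h"
    "f (u + h *\<^sub>R w + h *\<^sub>R v) - f (u + h *\<^sub>R w) - f (u + h *\<^sub>R v) + f u
      = h\<^sup>2 * F w v (u + s' *\<^sub>R w + t' *\<^sub>R v)"
    using second_difference_mvt[OF sm \<open>h > 0\<close>, of u w v] sub unfolding F_def by (metis add.commute)
  have "f (u + h *\<^sub>R w + h *\<^sub>R v) - f (u + h *\<^sub>R w) - f (u + h *\<^sub>R v) + f u = ?S"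
    by (simp add: algebra_simps)
  then have eq: "F v w (u + s *\<^sub>R v + t *\<^sub>R w) = F w v (u + s' *\<^sub>R w + t' *\<^sub>R v)"
    using st(5) st'(5) \<open>h > 0\<close> by simp
  have "dist (u + s *\<^sub>R v + t *\<^sub>R w) u < d" "dist (u + s' *\<^sub>R w + t' *\<^sub>R v) u < d"
    using near st st' by auto
  then have "\<bar>F v w (u + s *\<^sub>R v + t *\<^sub>R w) - F v w u\<bar> < \<epsilon>"
    "\<bar>F w v (u + s' *\<^sub>R w + t' *\<^sub>R v) - F w v u\<bar> < \<epsilon>"
    using d1(2) d2(2) by (auto simp: d_def)
  moreover have "\<bar>b - c\<bar> \<le> \<bar>a - b\<bar> + \<bar>a - c\<bar>" for a b c :: real by arith
  ultimately show False using eq unfolding \<epsilon>_def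
    by (metis add_strict_mono field_sum_of_halves not_less)
qed

lemma frechet_derivative_linear_image:
  assumes "bounded_linear L" and "F differentiable (at u)"
  shows "frechet_derivative (\<lambda>p. L (F p)) (at u) v = L (frechet_derivative F (at u) v)"
  using frechet_derivative_eqI[OF bounded_linear.has_derivative[OF assms(1)
        frechet_derivative_works[THEN iffD1, OF assms(2)]]] by simp

lemma second_derivative_symmetric:
  fixes F :: "'a::real_normed_vector \<Rightarrow> 'b::euclidean_space"
  assumes "open U" and sm: "smooth_on U F" and "u \<in> U"
  shows "frechet_derivative (\<lambda>p. frechet_derivative F (at p) v) (at u) w =
         frechet_derivative (\<lambda>p. frechet_derivative F (at p) w) (at u) v"
proof (rule euclidean_eqI)
  fix b :: 'b
  have lin: "bounded_linear (\<lambda>x. x \<bullet> b)" by (rule bounded_linear_inner_left)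
  have "frechet_derivative (\<lambda>p. frechet_derivative (\<lambda>p. F p \<bullet> b) (at p) v) (at u) w =
      frechet_derivative (\<lambda>p. frechet_derivative F (at p) v) (at u) w \<bullet> b" for v w
  proof -
    have "frechet_derivative (\<lambda>p. frechet_derivative (\<lambda>p. F p \<bullet> b) (at p) v) (at u) w
        = frechet_derivative (\<lambda>p. frechet_derivative F (at p) v \<bullet> b) (at u) w"
      using frechet_derivative_linear_image[OF lin smooth_on_differentiable[OF sm]]
      by (intro fun_cong[OF frechet_derivative_cong_open(1)[OF \<open>open U\<close> \<open>u \<in> U\<close>]])
    also have "\<dots> = frechet_derivative (\<lambda>p. frechet_derivative F (at p) v) (at u) w \<bullet> b"
      using frechet_derivative_linear_image[OF lin smooth_on_differentiable[OF smooth_on_frechet_derivative[OF sm] \<open>u \<in> U\<close>]] .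
    finally show ?thesis .
  qed
  then show "frechet_derivative (\<lambda>p. frechet_derivative F (at p) v) (at u) w \<bullet> b =
      frechet_derivative (\<lambda>p. frechet_derivative F (at p) w) (at u) v \<bullet> b"
    using second_derivative_symmetric_real[OF \<open>open U\<close> smooth_on_linear[OF \<open>open U\<close> lin sm] \<open>u \<in> U\<close>, of v w]
    by simp
qed

section \<open>Derivatives along vector fields of the plane\<close>

text \<open>The direction moves with the point, so that one can differentiate along an orthonormal
  frame; the price is that iterated derivatives no longer commute.\<close>

definition dirD :: "(real^2 \<Rightarrow> real^2) \<Rightarrow> (real^2 \<Rightarrow> 'b::real_normed_vector) \<Rightarrow> real^2 \<Rightarrow> 'b" where
  "dirD e F u = frechet_derivative F (at u) (e u)"

lemma partial_eq_dirD: "partial i F = dirD (\<lambda>_. axis i 1) F"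
  by (simp add: partial_def dirD_def fun_eq_iff)

lemma dirD_cong_open:
  "open U \<Longrightarrow> u \<in> U \<Longrightarrow> (\<And>p. p \<in> U \<Longrightarrow> F p = G p) \<Longrightarrow> dirD e F u = dirD e G u"
  using frechet_derivative_cong_open(1)[of U u F G] by (simp add: dirD_def)

lemma dirD_const [simp]: "dirD e (\<lambda>_. a) u = 0"
  by (simp add: dirD_def)

lemma dirD_linear:
  "bounded_linear L \<Longrightarrow> F differentiable (at u) \<Longrightarrow> dirD e (\<lambda>p. L (F p)) u = L (dirD e F u)"
  by (simp add: dirD_def frechet_derivative_linear_image)

lemma dirD_bilinear:
  assumes "bounded_bilinear B" and "F differentiable (at u)" and "G differentiable (at u)"
  shows "dirD e (\<lambda>p. B (F p) (G p)) u = B (dirD e F u) (G u) + B (F u) (dirD e G u)"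
  using frechet_derivative_eqI[OF bounded_bilinear.FDERIV[OF assms(1)
        frechet_derivative_works[THEN iffD1, OF assms(2)] frechet_derivative_works[THEN iffD1, OF assms(3)]]]
  by (simp add: dirD_def)

lemma dirD_add:
  assumes "F differentiable (at u)" and "G differentiable (at u)"
  shows "dirD e (\<lambda>p. F p + G p) u = dirD e F u + dirD e G u"
  using frechet_derivative_eqI[OF has_derivative_add[OF
        frechet_derivative_works[THEN iffD1, OF assms(1)] frechet_derivative_works[THEN iffD1, OF assms(2)]]]
  by (simp add: dirD_def)

lemma dirD_uminus:
  "F differentiable (at u) \<Longrightarrow> dirD e (\<lambda>p. - F p) u = - dirD e F u"
  by (rule dirD_linear[OF bounded_linear_minus[OF bounded_linear_ident]])

lemma dirD_diff:
  assumes "F differentiable (at u)" and "G differentiable (at u)"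
  shows "dirD e (\<lambda>p. F p - G p) u = dirD e F u - dirD e G u"
  using frechet_derivative_eqI[OF has_derivative_diff[OF
        frechet_derivative_works[THEN iffD1, OF assms(1)] frechet_derivative_works[THEN iffD1, OF assms(2)]]]
  by (simp add: dirD_def)

lemma dirD_sum:
  assumes "\<And>i. i \<in> I \<Longrightarrow> F i differentiable (at u)"
  shows "dirD e (\<lambda>p. \<Sum>i\<in>I. F i p) u = (\<Sum>i\<in>I. dirD e (F i) u)"
  using frechet_derivative_eqI[OF has_derivative_sum[of I F "\<lambda>i. frechet_derivative (F i) (at u)" "at u"]]
    assms frechet_derivative_works by (fastforce simp: dirD_def)

lemma dirD_scaleR:
  "f differentiable (at u) \<Longrightarrow> F differentiable (at u) \<Longrightarrow>
    dirD e (\<lambda>p. f p *\<^sub>R F p) u = dirD e f u *\<^sub>R F u + f u *\<^sub>R dirD e F u"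
  by (rule dirD_bilinear[OF bounded_bilinear_scaleR])

lemma dirD_mult:
  fixes f g :: "real^2 \<Rightarrow> real"
  shows "f differentiable (at u) \<Longrightarrow> g differentiable (at u) \<Longrightarrow>
    dirD e (\<lambda>p. f p * g p) u = dirD e f u * g u + f u * dirD e g u"
  by (rule dirD_bilinear[OF bounded_bilinear_mult])

lemma vec2_eq_sum: "(w::real^2) = (\<Sum>i\<in>UNIV. w $ i *\<^sub>R axis i 1)"
  by (simp add: vec_eq_iff forall_2 sum_2 axis_def)

lemma frechet_derivative_eq_partial:
  assumes "F differentiable (at u)"
  shows "frechet_derivative F (at u) w = (\<Sum>i\<in>UNIV. w $ i *\<^sub>R partial i F u)"
proof -
  note lin = linear_frechet_derivative[OF assms]
  have "frechet_derivative F (at u) w = frechet_derivative F (at u) (\<Sum>i\<in>UNIV. w $ i *\<^sub>R axis i 1)"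
    using arg_cong[OF vec2_eq_sum[of w], of "frechet_derivative F (at u)"] .
  also have "\<dots> = (\<Sum>i\<in>UNIV. w $ i *\<^sub>R partial i F u)"
    by (simp add: linear_sum[OF lin] linear_cmul[OF lin] partial_def)
  finally show ?thesis .
qed

lemma dirD_eq_partial:
  "F differentiable (at u) \<Longrightarrow> dirD e F u = (\<Sum>i\<in>UNIV. e u $ i *\<^sub>R partial i F u)"
  by (simp add: dirD_def frechet_derivative_eq_partial)

lemma smooth_on_partial: "smooth_on U F \<Longrightarrow> smooth_on U (partial i F)"
  using smooth_on_frechet_derivative[of U F "axis i 1"] by (simp add: partial_def[abs_def])

lemma smooth_on_nth: "open U \<Longrightarrow> smooth_on U e \<Longrightarrow> smooth_on U (\<lambda>p. e p $ i)"
  by (rule smooth_on_linear[OF _ bounded_linear_vec_nth])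

lemma smooth_on_dirD:
  assumes "open U" and "smooth_on U e" and "smooth_on U F"
  shows "smooth_on U (dirD e F)"
proof -
  have "smooth_on U (\<lambda>u. \<Sum>i\<in>UNIV. e u $ i *\<^sub>R partial i F u)"
    using assms by (intro smooth_on_sum smooth_on_scaleR smooth_on_nth smooth_on_partial)
  then show ?thesis
    by (rule smooth_on_cong[OF assms(1), THEN iffD2, rotated])
      (rule dirD_eq_partial[OF smooth_on_differentiable[OF assms(3)]])
qed

lemma partial_commute:
  fixes F :: "real^2 \<Rightarrow> 'b::euclidean_space"
  shows "open U \<Longrightarrow> smooth_on U F \<Longrightarrow> u \<in> U \<Longrightarrow> partial i (partial j F) u = partial j (partial i F) u"
  using second_derivative_symmetric[of U F u "axis j 1" "axis i 1"] by (simp add: partial_def[abs_def])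

text \<open>The second sum arises where the outer derivative hits the moving direction
  \<open>e'\<close>. The commutator, the tensoriality of the second fundamental form and the
  Laplacian in the frame all come from this expansion.\<close>

lemma dirD_dirD:
  fixes F :: "real^2 \<Rightarrow> 'b::euclidean_space"
  assumes U: "open U" "u \<in> U" and e': "smooth_on U e'" and F: "smooth_on U F"
  shows "dirD e (dirD e' F) u =
    (\<Sum>i\<in>UNIV. \<Sum>j\<in>UNIV. (e u $ i * e' u $ j) *\<^sub>R partial i (partial j F) u)
    + (\<Sum>j\<in>UNIV. dirD e e' u $ j *\<^sub>R partial j F u)"
proof -
  have sm: "smooth_on U (partial j F)" "smooth_on U (\<lambda>p. e' p $ j)" for j
    using smooth_on_partial[OF F] smooth_on_nth[OF U(1) e'] by auto
  note d = smooth_on_differentiable[OF sm(1) U(2)] smooth_on_differentiable[OF sm(2) U(2)]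
  have "dirD e (dirD e' F) u = dirD e (\<lambda>p. \<Sum>j\<in>UNIV. e' p $ j *\<^sub>R partial j F p) u"
    using dirD_eq_partial[OF smooth_on_differentiable[OF F]] by (intro dirD_cong_open[OF U]) simp
  also have "\<dots> = (\<Sum>j\<in>UNIV. dirD e (\<lambda>p. e' p $ j *\<^sub>R partial j F p) u)"
    using smooth_on_differentiable[OF smooth_on_scaleR[OF U(1) sm(2) sm(1)] U(2)]
    by (intro dirD_sum) simp
  also have "\<dots> = (\<Sum>j\<in>UNIV. dirD e e' u $ j *\<^sub>R partial j F u + e' u $ j *\<^sub>R dirD e (partial j F) u)"
    using d dirD_linear[OF bounded_linear_vec_nth smooth_on_differentiable[OF e' U(2)]]
    by (simp add: dirD_scaleR)
  also have "\<dots> = (\<Sum>j\<in>UNIV. dirD e e' u $ j *\<^sub>R partial j F u)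
      + (\<Sum>j\<in>UNIV. \<Sum>i\<in>UNIV. (e u $ i * e' u $ j) *\<^sub>R partial i (partial j F) u)"
    by (simp add: sum.distrib dirD_eq_partial[OF d(1)] scaleR_sum_right mult.commute)
  finally show ?thesis
    by (subst (asm) sum.swap) (simp add: add.commute)
qed

text \<open>The second-order parts cancel by symmetry of the partial derivatives. What remains is
  the derivative along the Lie bracket of the two fields,
  \<open>dirD e e' u - dirD e' e u\<close>.\<close>

lemma dirD_commutator:
  fixes F :: "real^2 \<Rightarrow> 'b::euclidean_space"
  assumes U: "open U" "u \<in> U" and e: "smooth_on U e" "smooth_on U e'" and F: "smooth_on U F"
  shows "dirD e (dirD e' F) u - dirD e' (dirD e F) u =
    frechet_derivative F (at u) (dirD e e' u - dirD e' e u)"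
proof -
  have "(\<Sum>i\<in>UNIV. \<Sum>j\<in>UNIV. (e u $ i * e' u $ j) *\<^sub>R partial i (partial j F) u)
      = (\<Sum>i\<in>UNIV. \<Sum>j\<in>UNIV. (e' u $ i * e u $ j) *\<^sub>R partial i (partial j F) u)"
    using partial_commute[OF U(1) F U(2)]
    by (subst sum.swap) (simp add: mult.commute)
  then show ?thesis
    by (simp add: dirD_dirD[OF U e(1) F] dirD_dirD[OF U e(2) F] scaleR_diff_left sum_subtractf
        frechet_derivative_eq_partial[OF smooth_on_differentiable[OF F U(2)]])
qed

section \<open>The product metric\<close>

lemma bounded_bilinear_prod_inner: "bounded_bilinear (prod_inner c)"
proof -
  have "bilinear (prod_inner c)"
    unfolding bilinear_def
    by (auto intro!: linearI simp: prod_inner_def model_inner_def inner_add_left inner_add_right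
        algebra_simps add_divide_distrib)
  then show ?thesis by (simp add: bilinear_conv_bounded_bilinear)
qed

interpretation prod_inner: bounded_bilinear "prod_inner c" for c
  by (rule bounded_bilinear_prod_inner)

lemmas prod_inner_simps =
  prod_inner.add_left prod_inner.add_right prod_inner.diff_left prod_inner.diff_right
  prod_inner.scaleR_left prod_inner.scaleR_right prod_inner.minus_left prod_inner.minus_right
  prod_inner.zero_left prod_inner.zero_right prod_inner.sum_left prod_inner.sum_right

lemma prod_inner_commute: "prod_inner c v w = prod_inner c w v"
  by (simp add: prod_inner_def model_inner_def inner_commute mult.commute)

lemma prod_inner_xi: "prod_inner c xi w = snd w" "prod_inner c w xi = snd w"
  by (simp_all add: prod_inner_def model_inner_def xi_def)

lemma subspace_prod_tangent: "subspace (prod_tangent c p)"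
proof -
  have "linear (\<lambda>v::amb. fst (fst p) * fst (fst v) + c * (snd (fst p) \<bullet> snd (fst v)))"
    by (rule linearI) (simp_all add: inner_add_right algebra_simps)
  then show ?thesis unfolding prod_tangent_def by (rule linear_subspace_kernel)
qed

lemma xi_prod_tangent: "xi \<in> prod_tangent c p"
  by (simp add: prod_tangent_def xi_def)

lemma position_not_tangent:
  "p \<in> space_form c \<times> UNIV \<Longrightarrow> (fst p, 0) \<notin> prod_tangent c p"
  by (auto simp: space_form_def prod_tangent_def power2_eq_square)

text \<open>For \<open>c = 0\<close> the form ignores the first coordinate and the position vector
  need not be orthogonal to tangent vectors. The factor \<open>c\<close>, which accompanies the
  position in \<open>prod_conn\<close>, makes orthogonality hold uniformly.\<close>

lemma prod_inner_position_tangent: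
  assumes "p \<in> space_form c \<times> UNIV" and "v \<in> prod_tangent c p"
  shows "c * prod_inner c (fst p, 0) v = 0"
proof (cases "c = 0")
  case False
  then have "c * prod_inner c (fst p, 0) v = fst (fst p) * fst (fst v) + c * (snd (fst p) \<bullet> snd (fst v))"
    by (simp add: prod_inner_def model_inner_def algebra_simps)
  then show ?thesis using assms(2) by (simp add: prod_tangent_def)
qed simp

text \<open>This is \<open><P, P> = 1/c\<close>, multiplied by the square of \<open>c\<close> so
  that it survives at \<open>c = 0\<close>.\<close>

lemma prod_inner_position_position:
  assumes "p \<in> space_form c \<times> UNIV"
  shows "c * (c * prod_inner c (fst p, 0) (fst p, 0)) = c"
proof (cases "c = 0")
  case False
  then have "c * prod_inner c (fst p, 0) (fst p, 0) = 1"
    using assms by (auto simp: prod_inner_def model_inner_def space_form_def algebra_simps power2_eq_square)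
  then show ?thesis by simp
qed simp

lemma prod_inner_pos_tangent:
  assumes p: "p \<in> space_form c \<times> UNIV" and v: "v \<in> prod_tangent c p" "v \<noteq> 0"
  shows "prod_inner c v v > 0"
proof -
  obtain a z t where p_eq: "p = ((a, z), t)" by (metis surj_pair)
  obtain b y s where v_eq: "v = ((b, y), s)" by (metis surj_pair)
  have az: "a\<^sup>2 + c * (z \<bullet> z) = 1" "c \<le> 0 \<Longrightarrow> a > 0"
    using p by (auto simp: space_form_def p_eq)
  have tan: "a * b + c * (z \<bullet> y) = 0"
    using v(1) by (simp add: prod_tangent_def p_eq v_eq)
  consider "c > 0" | "c = 0" | "c < 0" by linarith
  then have "(if c = 0 then 0 else b * b / c) + y \<bullet> y + s * s > 0"
  proof cases
    case 1
    then have nonneg: "b * b / c \<ge> 0" "s * s \<ge> 0" "y \<bullet> y \<ge> 0" by auto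
    consider "b \<noteq> 0" | "y \<noteq> 0" | "s \<noteq> 0" using v(2) by (auto simp: v_eq zero_prod_def)
    then have "b * b / c > 0 \<or> s * s > 0 \<or> y \<bullet> y > 0"
      using 1 by cases (auto simp: zero_less_mult_iff zero_less_divide_iff)
    then have "b * b / c + y \<bullet> y + s * s > 0" using nonneg by linarith
    then show ?thesis using 1 by simp
  next
    case 2
    then have "b = 0" using az tan by simp
    then have "y \<noteq> 0 \<or> s \<noteq> 0" using v(2) by (auto simp: v_eq zero_prod_def)
    then have "s * s > 0 \<or> y \<bullet> y > 0" by (auto simp: zero_less_mult_iff)
    moreover have "s * s \<ge> 0" "y \<bullet> y \<ge> 0" by auto
    ultimately have "y \<bullet> y + s * s > 0" by linarith
    then show ?thesis using 2 by simp
  next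
    case 3
    then have "a > 0" using az by simp
    \<comment> \<open>Hyperbolic case: tangency expresses \<open>a b\<close> through the product of
      \<open>z\<close> and \<open>y\<close>, and Cauchy-Schwarz together with
      \<open>c |z|^2 = 1 - a^2\<close> shows that the negative term \<open>b^2 / c\<close> cannot
      outweigh \<open>|y|^2\<close>.\<close>
    have cs: "(z \<bullet> y)\<^sup>2 \<le> (z \<bullet> z) * (y \<bullet> y)" by (rule Cauchy_Schwarz_ineq)
    have "a * b = - c * (z \<bullet> y)" using tan by simp
    then have "(a * b)\<^sup>2 = (c * (z \<bullet> y))\<^sup>2" by simp
    then have "a\<^sup>2 * (b * b) = c\<^sup>2 * (z \<bullet> y)\<^sup>2"
      by (simp add: power_mult_distrib power2_eq_square[of b])
    then have "a\<^sup>2 * (b * b / c) = c * (z \<bullet> y)\<^sup>2"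
      using 3 by (simp add: field_simps power2_eq_square)
    also have "\<dots> \<ge> c * ((z \<bullet> z) * (y \<bullet> y))"
      using cs 3 by (intro mult_left_mono_neg) auto
    also have "c * ((z \<bullet> z) * (y \<bullet> y)) = (1 - a\<^sup>2) * (y \<bullet> y)"
      using az(1) by (metis add_diff_cancel_left' mult.assoc add.commute)
    finally have "a\<^sup>2 * (b * b / c + y \<bullet> y) \<ge> y \<bullet> y" by (simp add: algebra_simps)
    then have "a\<^sup>2 * (b * b / c + y \<bullet> y + s * s) \<ge> y \<bullet> y + a\<^sup>2 * (s * s)" by (simp add: algebra_simps)
    moreover have "y \<bullet> y + a\<^sup>2 * (s * s) > 0"
    proof (cases "y = 0")
      case True
      then have "b = 0" using tan \<open>a > 0\<close> by simp
      then have "s \<noteq> 0" using True v(2) by (auto simp: v_eq zero_prod_def)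
      then show ?thesis using \<open>a > 0\<close> True by (auto simp: zero_less_mult_iff)
    next
      case False
      then show ?thesis using \<open>a > 0\<close> by (intro add_pos_nonneg) auto
    qed
    ultimately have "a\<^sup>2 * (b * b / c + y \<bullet> y + s * s) > 0" by linarith
    then show ?thesis using \<open>a > 0\<close> 3 by (simp add: zero_less_mult_iff)
  qed
  then show ?thesis by (simp add: prod_inner_def model_inner_def v_eq split: if_splits)
qed

section \<open>Orthonormal bases of the tangent spaces\<close>

lemma independent_orthonormal:
  assumes "finite I" and "\<And>i j. i \<in> I \<Longrightarrow> j \<in> I \<Longrightarrow> prod_inner c (b i) (b j) = (if i = j then 1 else 0)"
  shows "independent (b ` I)" and "inj_on b I"
proof -
  show inj: "inj_on b I"
    using assms(2) by (intro inj_onI) (metis zero_neq_one)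
  show "independent (b ` I)"
    unfolding independent_explicit_finite_subsets
  proof (intro allI impI ballI)
    fix S f v
    assume S: "S \<subseteq> b ` I" "finite S" and 0: "(\<Sum>v\<in>S. f v *\<^sub>R v) = 0" and "v \<in> S"
    have "prod_inner c w v = (if w = v then 1 else 0)" if "w \<in> S" for w
    proof -
      obtain i j where "i \<in> I" "j \<in> I" "w = b i" "v = b j" using S(1) \<open>v \<in> S\<close> \<open>w \<in> S\<close> by blast
      then show ?thesis using assms(2) inj by (auto simp: inj_on_eq_iff)
    qed
    \<comment> \<open>Pairing with \<open>v\<close> isolates its coefficient, which works for a form
      that may be indefinite on \<open>amb\<close>.\<close>
    then have "prod_inner c (\<Sum>v\<in>S. f v *\<^sub>R v) v = (\<Sum>w\<in>S. if w = v then f w else 0)"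
      by (auto simp: prod_inner_simps intro!: sum.cong)
    then show "f v = 0" using 0 S(2) \<open>v \<in> S\<close> by (simp add: prod_inner_simps)
  qed
qed

text \<open>The tangent space is a proper subspace of the five-dimensional space \<open>amb\<close>.\<close>

lemma orthonormal_expansion:
  fixes b :: "'i \<Rightarrow> amb"
  assumes p: "p \<in> space_form c \<times> UNIV" and I: "finite I" "card I = 4"
    and b: "\<And>i. i \<in> I \<Longrightarrow> b i \<in> prod_tangent c p"
    and on: "\<And>i j. i \<in> I \<Longrightarrow> j \<in> I \<Longrightarrow> prod_inner c (b i) (b j) = (if i = j then 1 else 0)"
    and w: "w \<in> prod_tangent c p"
  shows "w = (\<Sum>i\<in>I. prod_inner c w (b i) *\<^sub>R b i)"
proof (rule ccontr)
  define r where "r = w - (\<Sum>i\<in>I. prod_inner c w (b i) *\<^sub>R b i)"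
  assume "\<not> ?thesis"
  then have "r \<noteq> 0" by (simp add: r_def)
  have r: "r \<in> prod_tangent c p"
    unfolding r_def using w b
    by (intro subspace_diff[OF subspace_prod_tangent] subspace_sum[OF subspace_prod_tangent]
        subspace_scale[OF subspace_prod_tangent]) auto
  have orth: "prod_inner c r (b j) = 0" if "j \<in> I" for j
  proof -
    have "(\<Sum>i\<in>I. prod_inner c w (b i) * prod_inner c (b i) (b j)) = (\<Sum>i\<in>I. if i = j then prod_inner c w (b i) else 0)"
      using on that by (intro sum.cong) auto
    then show ?thesis using that I by (simp add: r_def prod_inner_simps)
  qed
  \<comment> \<open>A nonzero remainder is normalised, by positivity on the tangent space, to a
    fifth orthonormal tangent vector. Five independent vectors span \<open>amb\<close>, which would
    make the position vector tangent.\<close>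
  define q where "q = r /\<^sub>R sqrt (prod_inner c r r)"
  have pos: "prod_inner c r r > 0" using prod_inner_pos_tangent[OF p r \<open>r \<noteq> 0\<close>] .
  then have qq: "prod_inner c q q = 1"
    by (simp add: q_def prod_inner_simps field_simps flip: power2_eq_square)
  have qb: "prod_inner c q (b j) = 0" "prod_inner c (b j) q = 0" if "j \<in> I" for j
    using orth[OF that] prod_inner_commute[of c "b j"] by (simp_all add: q_def prod_inner_simps)
  have qt: "q \<in> prod_tangent c p"
    unfolding q_def by (rule subspace_scale[OF subspace_prod_tangent r])
  define b' where "b' = (\<lambda>i. case i of None \<Rightarrow> q | Some i \<Rightarrow> b i)"
  define J where "J = insert None (Some ` I)"
  have J: "finite J" "card J = 5" using I by (simp_all add: J_def card_image)
  have on': "prod_inner c (b' i) (b' j) = (if i = j then 1 else 0)" if "i \<in> J" "j \<in> J" for i j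
    using that qq qb on by (auto simp: J_def b'_def split: if_splits)
  have "card (b' ` J) = 5"
    using independent_orthonormal(2)[OF J(1) on'] J by (simp add: card_image)
  moreover have "DIM(amb) = 5" by simp
  ultimately have "UNIV \<subseteq> span (b' ` J)"
    using independent_orthonormal(1)[OF J(1) on']
    by (intro card_ge_dim_independent) auto
  moreover have "span (b' ` J) \<subseteq> prod_tangent c p"
    using qt b by (intro span_minimal subspace_prod_tangent) (auto simp: J_def b'_def)
  ultimately show False using position_not_tangent[OF p] by auto
qed

text \<open>The polarisation of the defining equation of \<open>space_form c\<close>. For
  \<open>c \<noteq> 0\<close> it is \<open>c\<close> times the metric of the model; at
  \<open>c = 0\<close> it retains the coordinate \<open>a\<close>, which the metric forgets.\<close>

definition position_form :: "real \<Rightarrow> amb \<Rightarrow> amb \<Rightarrow> real" where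
  "position_form c p v = fst (fst p) * fst (fst v) + c * (snd (fst p) \<bullet> snd (fst v))"

lemma bounded_bilinear_position_form: "bounded_bilinear (position_form c)"
proof -
  have "bilinear (position_form c)"
    unfolding bilinear_def
    by (auto intro!: linearI simp: position_form_def inner_add_left inner_add_right algebra_simps)
  then show ?thesis by (simp add: bilinear_conv_bounded_bilinear)
qed

interpretation position_form: bounded_bilinear "position_form c" for c
  by (rule bounded_bilinear_position_form)

lemma position_form_commute: "position_form c v w = position_form c w v"
  by (simp add: position_form_def inner_commute mult.commute)

lemma prod_tangent_iff: "v \<in> prod_tangent c p \<longleftrightarrow> position_form c p v = 0"
  by (simp add: prod_tangent_def position_form_def)

lemma position_form_self:
  "p \<in> space_form c \<times> UNIV \<Longrightarrow> position_form c p p = 1"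
  "p \<in> space_form c \<times> UNIV \<Longrightarrow> position_form c p (fst p, 0) = 1"
  by (auto simp: space_form_def position_form_def power2_eq_square)

lemma position_form_tangent:
  assumes "p \<in> space_form c \<times> UNIV" "v \<in> prod_tangent c p"
  shows "position_form c v w = c * model_inner c (fst v) (fst w)"
proof (cases "c = 0")
  case True
  then have "fst (fst v) = 0"
    using assms by (auto simp: prod_tangent_def space_form_def)
  then show ?thesis using True by (simp add: position_form_def)
next
  case False
  then show ?thesis by (simp add: position_form_def model_inner_def algebra_simps)
qed

text \<open>Obtained by differentiating \<open>position_form c X X = 1\<close>.\<close>

lemma dirD_prod_tangent:
  assumes "open V" and "smooth_on V X" and X: "\<And>u. u \<in> V \<Longrightarrow> X u \<in> space_form c \<times> UNIV"
    and "u \<in> V"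
  shows "dirD e X u \<in> prod_tangent c (X u)"
proof -
  note d = smooth_on_differentiable[OF assms(2,4)]
  have "dirD e (\<lambda>p. position_form c (X p) (X p)) u = dirD e (\<lambda>_. 1) u"
    using position_form_self(1)[OF X] by (intro dirD_cong_open[OF assms(1,4)]) simp
  then have "2 * position_form c (X u) (dirD e X u) = 0"
    using dirD_bilinear[OF bounded_bilinear_position_form d d, of e c] position_form_commute[of c "dirD e X u"]
    by simp
  then show ?thesis by (simp add: prod_tangent_iff)
qed

text \<open>Differentiating \<open>position_form c X W = 0\<close> gives the failure of the flat
  derivative to be tangent. The correction removes exactly this, since \<open>position_form\<close>
  of \<open>X\<close> with its projection to the space form factor is 1.\<close>

lemma conn_prod_tangent:
  assumes "open V" and "smooth_on V X" and X: "\<And>u. u \<in> V \<Longrightarrow> X u \<in> space_form c \<times> UNIV"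
    and W: "smooth_on V W" "\<And>u. u \<in> V \<Longrightarrow> W u \<in> prod_tangent c (X u)" and "u \<in> V"
  shows "dirD e W u + (c * model_inner c (fst (W u)) (fst (dirD e X u))) *\<^sub>R (fst (X u), 0)
    \<in> prod_tangent c (X u)"
proof -
  note d = smooth_on_differentiable[OF assms(2) \<open>u \<in> V\<close>] smooth_on_differentiable[OF W(1) \<open>u \<in> V\<close>]
  have "dirD e (\<lambda>p. position_form c (X p) (W p)) u = dirD e (\<lambda>_. 0) u"
    using W(2) by (intro dirD_cong_open[OF assms(1) \<open>u \<in> V\<close>]) (simp add: prod_tangent_iff)
  then have "position_form c (dirD e X u) (W u) + position_form c (X u) (dirD e W u) = 0"
    using dirD_bilinear[OF bounded_bilinear_position_form d, of e c] by simp
  moreover have "position_form c (dirD e X u) (W u) = c * model_inner c (fst (W u)) (fst (dirD e X u))"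
    using position_form_tangent[OF X[OF \<open>u \<in> V\<close>] W(2)[OF \<open>u \<in> V\<close>], of "dirD e X u"]
      position_form_commute[of c "W u"] by simp
  ultimately show ?thesis
    using position_form_self(2)[OF X[OF \<open>u \<in> V\<close>]]
    by (simp add: prod_tangent_iff position_form.add_right position_form.scaleR_right del: scaleR_Pair)
qed

lemma model_inner_fst: "model_inner c (fst v) (fst w) = prod_inner c v w - snd v * snd w"
  by (simp add: prod_inner_def)

lemma dirD_prod_inner:
  "F differentiable (at u) \<Longrightarrow> G differentiable (at u) \<Longrightarrow>
    dirD e (\<lambda>p. prod_inner c (F p) (G p)) u = prod_inner c (dirD e F u) (G u) + prod_inner c (F u) (dirD e G u)"
  by (rule dirD_bilinear[OF bounded_bilinear_prod_inner])

section \<open>Adapted orthonormal frames\<close>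

text \<open>\<open>E\<close> consists of vector fields on the parameter plane, so functions can be
  differentiated along them; their images under the differential of \<open>X\<close> are
  orthonormal. The normal indices 1 and 2 stand for the indices 3 and 4 of the statement.\<close>

locale adapted_frame =
  fixes c :: real and X :: "real^2 \<Rightarrow> amb" and V :: "(real^2) set"
    and E :: "2 \<Rightarrow> real^2 \<Rightarrow> real^2" and n :: "2 \<Rightarrow> real^2 \<Rightarrow> amb"
  assumes open_V: "open V" and smooth_X: "smooth_on V X"
    and X_in: "\<And>u. u \<in> V \<Longrightarrow> X u \<in> space_form c \<times> UNIV"
    and smooth_E: "\<And>a. smooth_on V (E a)"
    and orthonormal_e: "\<And>u a b. u \<in> V \<Longrightarrow>
      prod_inner c (dirD (E a) X u) (dirD (E b) X u) = (if a = b then 1 else 0)"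
    and smooth_n: "\<And>\<alpha>. smooth_on V (n \<alpha>)"
    and n_tangent: "\<And>u \<alpha>. u \<in> V \<Longrightarrow> n \<alpha> u \<in> prod_tangent c (X u)"
    and orthonormal_n: "\<And>u \<alpha> \<beta>. u \<in> V \<Longrightarrow> prod_inner c (n \<alpha> u) (n \<beta> u) = (if \<alpha> = \<beta> then 1 else 0)"
    and e_orth_n: "\<And>u a \<alpha>. u \<in> V \<Longrightarrow> prod_inner c (dirD (E a) X u) (n \<alpha> u) = 0"
begin

abbreviation ip :: "amb \<Rightarrow> amb \<Rightarrow> real" where "ip \<equiv> prod_inner c"
abbreviation D :: "2 \<Rightarrow> (real^2 \<Rightarrow> 'b::real_normed_vector) \<Rightarrow> real^2 \<Rightarrow> 'b" where "D a \<equiv> dirD (E a)"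
abbreviation e :: "2 \<Rightarrow> real^2 \<Rightarrow> amb" where "e a \<equiv> dirD (E a) X"
text \<open>The connection coefficients \<open><nabla_a e_b, e_d>\<close>. The flat derivative may
  replace the covariant one, here and in \<open>h\<close>, because they differ by \<open>c\<close>
  times a multiple of the position, which is orthogonal to tangent and normal frame vectors
  alike.\<close>

definition Om :: "2 \<Rightarrow> 2 \<Rightarrow> 2 \<Rightarrow> real^2 \<Rightarrow> real" where "Om a b d u = ip (D a (e b) u) (e d u)"
definition h :: "2 \<Rightarrow> 2 \<Rightarrow> 2 \<Rightarrow> real^2 \<Rightarrow> real" where "h \<alpha> a b u = ip (D a (e b) u) (n \<alpha> u)"
definition T :: "2 \<Rightarrow> real^2 \<Rightarrow> real" where "T a u = snd (e a u)"
definition \<nu> :: "2 \<Rightarrow> real^2 \<Rightarrow> real" where "\<nu> \<alpha> u = snd (n \<alpha> u)"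

lemmas smooth_dirD = smooth_on_dirD[OF open_V smooth_E]
lemmas smooth_e = smooth_dirD[OF smooth_X]
lemmas smooth_ip = smooth_on_bilinear[OF open_V bounded_bilinear_prod_inner]
lemmas differentiableI = smooth_on_differentiable

lemma smooth_Om: "smooth_on V (Om a b d)"
  unfolding Om_def[abs_def] by (intro smooth_ip smooth_dirD smooth_X)

lemma smooth_h: "smooth_on V (h \<alpha> a b)"
  unfolding h_def[abs_def] by (intro smooth_ip smooth_dirD smooth_X smooth_n)

lemma smooth_T: "smooth_on V (T a)"
  unfolding T_def[abs_def] by (intro smooth_on_linear[OF open_V bounded_linear_snd] smooth_e)

lemma smooth_\<nu>: "smooth_on V (\<nu> \<alpha>)"
  unfolding \<nu>_def[abs_def] by (intro smooth_on_linear[OF open_V bounded_linear_snd] smooth_n)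

lemma e_tangent: "u \<in> V \<Longrightarrow> e a u \<in> prod_tangent c (X u)"
  by (rule dirD_prod_tangent[OF open_V smooth_X X_in])

lemma tangent_expansion:
  assumes "u \<in> V" and "w \<in> prod_tangent c (X u)"
  shows "w = (\<Sum>d\<in>UNIV. ip w (e d u) *\<^sub>R e d u) + (\<Sum>\<alpha>\<in>UNIV. ip w (n \<alpha> u) *\<^sub>R n \<alpha> u)"
proof -
  let ?b = "\<lambda>i::2+2. case i of Inl a \<Rightarrow> e a u | Inr \<alpha> \<Rightarrow> n \<alpha> u"
  have "card (UNIV :: (2+2) set) = 4"
    by (simp add: card_UNIV_sum)
  moreover have "ip (n \<alpha> u) (e a u) = 0" for \<alpha> a
    using e_orth_n[OF assms(1)] prod_inner_commute by metis
  ultimately have "w = (\<Sum>i\<in>UNIV. ip w (?b i) *\<^sub>R ?b i)"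
    using assms(1) e_tangent n_tangent orthonormal_e orthonormal_n e_orth_n
    by (intro orthonormal_expansion[OF X_in[OF assms(1)] _ _ _ _ assms(2)]) (auto split: sum.split)
  then show ?thesis
    by (simp add: UNIV_Plus_UNIV[symmetric] sum.Plus del: UNIV_Plus_UNIV)
qed

lemma tangent_inner:
  assumes "u \<in> V" and "w \<in> prod_tangent c (X u)"
  shows "ip w w' = (\<Sum>d\<in>UNIV. ip w (e d u) * ip w' (e d u)) + (\<Sum>\<alpha>\<in>UNIV. ip w (n \<alpha> u) * ip w' (n \<alpha> u))"
  by (subst tangent_expansion[OF assms]) (simp add: prod_inner_simps prod_inner_commute[of c w'])

lemma derivative_tangent:
  assumes "u \<in> V" and "smooth_on V W" and "\<And>p. p \<in> V \<Longrightarrow> W p \<in> prod_tangent c (X p)"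
  shows "D a W u + (c * (ip (W u) (e a u) - snd (W u) * T a u)) *\<^sub>R (fst (X u), 0) \<in> prod_tangent c (X u)"
  using conn_prod_tangent[OF open_V smooth_X X_in assms(2,3,1)] by (simp add: model_inner_fst T_def)

lemma ip_position:
  assumes "u \<in> V" and "v \<in> prod_tangent c (X u)"
  shows "ip (w + (c * r) *\<^sub>R (fst (X u), 0)) v = ip w v"
  using prod_inner_position_tangent[OF X_in[OF assms(1)] assms(2)]
  by (auto simp: prod_inner_simps simp del: scaleR_Pair)

text \<open>The source of every ambient curvature term. A flat derivative has a component along the
  position besides its tangent and normal ones, and the product of two such components is the last
  summand. Only the space form factor is curved, so its bracket subtracts the product of the
  \<open>xi\<close> components from the full inner product.\<close>

lemma inner_derivatives:
  assumes u: "u \<in> V" and W: "smooth_on V W" "\<And>p. p \<in> V \<Longrightarrow> W p \<in> prod_tangent c (X p)"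
    and W': "smooth_on V W'" "\<And>p. p \<in> V \<Longrightarrow> W' p \<in> prod_tangent c (X p)"
  shows "ip (D a W u) (D b W' u) =
    (\<Sum>d\<in>UNIV. ip (D a W u) (e d u) * ip (D b W' u) (e d u))
    + (\<Sum>\<alpha>\<in>UNIV. ip (D a W u) (n \<alpha> u) * ip (D b W' u) (n \<alpha> u))
    + c * (ip (W u) (e a u) - snd (W u) * T a u) * (ip (W' u) (e b u) - snd (W' u) * T b u)"
proof -
  let ?P = "(fst (X u), 0) :: amb"
  let ?r = "ip (W u) (e a u) - snd (W u) * T a u" and ?r' = "ip (W' u) (e b u) - snd (W' u) * T b u"
  let ?w = "D a W u + (c * ?r) *\<^sub>R ?P" and ?w' = "D b W' u + (c * ?r') *\<^sub>R ?P"
  have t: "?w \<in> prod_tangent c (X u)" "?w' \<in> prod_tangent c (X u)"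
    using derivative_tangent[OF u W] derivative_tangent[OF u W'] by auto
  have "ip ?w ?w' = ip (D a W u) ?w'" using ip_position[OF u t(2)] .
  also have "\<dots> = ip (D a W u) (D b W' u) + ?r' * (c * ip ?P (D a W u))"
    by (simp add: prod_inner_simps prod_inner_commute[of c _ ?P] del: scaleR_Pair)
  \<comment> \<open>Tangency of the corrected derivative \<open>?w\<close> determines the position
    component of the flat one.\<close>
  also have "c * ip ?P (D a W u) = - c * ?r"
  proof -
    have "c * ip ?P ?w = c * ip ?P (D a W u) + ?r * (c * (c * ip ?P ?P))"
      by (simp add: prod_inner_simps distrib_left del: scaleR_Pair)
    then have "0 = c * ip ?P (D a W u) + ?r * c"
      by (simp only: prod_inner_position_tangent[OF X_in[OF u] t(1)] prod_inner_position_position[OF X_in[OF u]])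
    then show ?thesis by (simp add: mult.commute[of c] eq_neg_iff_add_eq_0)
  qed
  finally have "ip (D a W u) (D b W' u) = ip ?w ?w' + c * ?r * ?r'" by simp
  moreover have "ip ?w ?w' = (\<Sum>d\<in>UNIV. ip (D a W u) (e d u) * ip (D b W' u) (e d u))
    + (\<Sum>\<alpha>\<in>UNIV. ip (D a W u) (n \<alpha> u) * ip (D b W' u) (n \<alpha> u))"
    using tangent_inner[OF u t(1)] by (simp only: ip_position[OF u e_tangent[OF u]] ip_position[OF u n_tangent[OF u]])
  ultimately show ?thesis by simp
qed

text \<open>Here the parallelism of \<open>xi\<close> enters: the position correction has no
  component along the line, so the derivative of \<open><W, xi>\<close> is the pairing of
  \<open>xi\<close> with the covariant derivative of \<open>W\<close>.\<close>

lemma snd_derivative: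
  assumes u: "u \<in> V" and W: "smooth_on V W" "\<And>p. p \<in> V \<Longrightarrow> W p \<in> prod_tangent c (X p)"
  shows "D a (\<lambda>p. snd (W p)) u = (\<Sum>d\<in>UNIV. ip (D a W u) (e d u) * T d u) + (\<Sum>\<alpha>\<in>UNIV. ip (D a W u) (n \<alpha> u) * \<nu> \<alpha> u)"
proof -
  let ?r = "ip (W u) (e a u) - snd (W u) * T a u"
  let ?w = "D a W u + (c * ?r) *\<^sub>R (fst (X u), 0)"
  have "D a (\<lambda>p. snd (W p)) u = snd ?w"
    using dirD_linear[OF bounded_linear_snd differentiableI[OF W(1) u]] by simp
  also have "\<dots> = ip ?w xi" by (simp only: prod_inner_xi)
  also have "\<dots> = (\<Sum>d\<in>UNIV. ip (D a W u) (e d u) * T d u) + (\<Sum>\<alpha>\<in>UNIV. ip (D a W u) (n \<alpha> u) * \<nu> \<alpha> u)"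
    using tangent_inner[OF u derivative_tangent[OF u W], of a xi]
    by (simp only: ip_position[OF u e_tangent[OF u]] ip_position[OF u n_tangent[OF u]] prod_inner_xi T_def \<nu>_def)
  finally show ?thesis .
qed

section \<open>Structure equations of the frame\<close>

lemma Om_skew: "u \<in> V \<Longrightarrow> Om a b d u = - Om a d b u"
proof -
  assume u: "u \<in> V"
  have "D a (\<lambda>p. ip (e b p) (e d p)) u = D a (\<lambda>_. if b = d then 1 else 0) u"
    using orthonormal_e by (intro dirD_cong_open[OF open_V u]) simp
  then show ?thesis
    using prod_inner_commute[of c "e b u"]
    by (simp add: dirD_prod_inner differentiableI[OF smooth_e u] Om_def)
qed

lemma derivative_n: "u \<in> V \<Longrightarrow> ip (D a (n \<alpha>) u) (e b u) = - h \<alpha> a b u"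
proof -
  assume u: "u \<in> V"
  have "D a (\<lambda>p. ip (e b p) (n \<alpha> p)) u = D a (\<lambda>_. 0) u"
    using e_orth_n by (intro dirD_cong_open[OF open_V u]) simp
  then show ?thesis
    using prod_inner_commute[of c "e b u"]
    by (simp add: dirD_prod_inner differentiableI[OF smooth_e u] differentiableI[OF smooth_n u] h_def)
qed

lemma derivative_T:
  "u \<in> V \<Longrightarrow> D a (T b) u = (\<Sum>d\<in>UNIV. Om a b d u * T d u) + (\<Sum>\<alpha>\<in>UNIV. h \<alpha> a b u * \<nu> \<alpha> u)"
  using snd_derivative[OF _ smooth_e e_tangent] by (simp add: T_def[abs_def] Om_def h_def)

text \<open>A linear relation among the \<open>E d u\<close> would pass to their orthonormal images
  \<open>e d u\<close>; two independent vectors span the plane.\<close>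

lemma frame_span:
  assumes "u \<in> V"
  obtains \<kappa> where "k = (\<Sum>d\<in>UNIV. \<kappa> d *\<^sub>R E d u)"
proof -
  have lin: "linear (frechet_derivative X (at u))"
    using linear_frechet_derivative[OF differentiableI[OF smooth_X assms]] .
  have fin: "finite (UNIV :: 2 set)" by simp
  have on: "prod_inner c (e i u) (e j u) = (if i = j then 1 else 0)" for i j
    using orthonormal_e[OF assms] .
  have inj: "inj (\<lambda>a. E a u)"
  proof (rule injI)
    fix a b assume "E a u = E b u"
    then have "e a u = e b u" by (simp add: dirD_def)
    then show "a = b" using on[of a a] on[of a b] by (metis zero_neq_one)
  qed
  have ind: "independent (range (\<lambda>a. E a u))"
  proof
    assume "dependent (range (\<lambda>a. E a u))"
    then obtain r f where r: "r (E f u) \<noteq> 0" "(\<Sum>v\<in>range (\<lambda>a. E a u). r v *\<^sub>R v) = 0"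
      unfolding dependent_finite[OF finite_imageI[OF fin]] by blast
    have "(\<Sum>d\<in>UNIV. r (E d u) *\<^sub>R E d u) = 0"
      using r(2) by (simp only: sum.reindex[OF inj] o_def)
    then have "frechet_derivative X (at u) (\<Sum>d\<in>UNIV. r (E d u) *\<^sub>R E d u) = 0"
      by (simp only: linear_0[OF lin])
    then have "(\<Sum>d\<in>UNIV. r (E d u) *\<^sub>R e d u) = 0"
      by (simp add: linear_sum[OF lin] linear_cmul[OF lin] dirD_def)
    then have "ip (\<Sum>d\<in>UNIV. r (E d u) *\<^sub>R e d u) (e f u) = 0"
      by (simp only: prod_inner.zero_left)
    then show False using r(1) by (simp add: prod_inner_simps on if_distrib cong: if_cong)
  qed
  have "card (range (\<lambda>a. E a u)) = 2" using inj by (simp add: card_image)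
  then have "UNIV \<subseteq> span (range (\<lambda>a. E a u))"
    by (intro card_ge_dim_independent[OF _ ind]) auto
  then have "k \<in> span (range (\<lambda>a. E a u))" by auto
  then obtain r where "k = (\<Sum>v\<in>range (\<lambda>a. E a u). r v *\<^sub>R v)"
    by (auto simp: span_finite)
  then have "k = (\<Sum>d\<in>UNIV. r (E d u) *\<^sub>R E d u)"
    by (simp only: sum.reindex[OF inj] o_def)
  then show thesis by (rule that[of "\<lambda>d. r (E d u)"])
qed

text \<open>Expand the bracket of \<open>E a\<close> and \<open>E b\<close> in the frame and apply
  the commutator identity to \<open>X\<close> itself: the tangent components determine the
  coefficients in terms of \<open>Om\<close>, and the vanishing normal components give the symmetry
  of \<open>h\<close>. The coefficients then serve for every \<open>F\<close>.\<close>

lemma torsion_free: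
  fixes F :: "real^2 \<Rightarrow> 'b::euclidean_space"
  assumes u: "u \<in> V"
  shows "smooth_on V F \<Longrightarrow> D a (D b F) u - D b (D a F) u = (\<Sum>d\<in>UNIV. (Om a b d u - Om b a d u) *\<^sub>R D d F u)"
    and "h \<alpha> a b u = h \<alpha> b a u"
proof -
  obtain \<kappa> where \<kappa>: "D a (E b) u - D b (E a) u = (\<Sum>d\<in>UNIV. \<kappa> d *\<^sub>R E d u)"
    using frame_span[OF u] .
  have comm: "D a (D b G) u - D b (D a G) u = (\<Sum>d\<in>UNIV. \<kappa> d *\<^sub>R D d G u)"
    if "smooth_on V G" for G :: "real^2 \<Rightarrow> 'z::euclidean_space"
  proof -
    note lin = linear_frechet_derivative[OF differentiableI[OF that u]]
    have "D a (D b G) u - D b (D a G) u = frechet_derivative G (at u) (\<Sum>d\<in>UNIV. \<kappa> d *\<^sub>R E d u)"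
      using dirD_commutator[OF open_V u smooth_E smooth_E that] by (simp only: \<kappa>)
    then show ?thesis by (simp add: linear_sum[OF lin] linear_cmul[OF lin] dirD_def)
  qed
  note eX = comm[OF smooth_X]
  have "ip (D a (e b) u - D b (e a) u) (e d u) = \<kappa> d" for d
    unfolding eX by (simp add: prod_inner_simps orthonormal_e[OF u] if_distrib cong: if_cong)
  then have "\<kappa> d = Om a b d u - Om b a d u" for d
    by (simp add: Om_def prod_inner_simps)
  then show "smooth_on V F \<Longrightarrow> D a (D b F) u - D b (D a F) u = (\<Sum>d\<in>UNIV. (Om a b d u - Om b a d u) *\<^sub>R D d F u)"
    using comm by simp
  have "ip (D a (e b) u - D b (e a) u) (n \<alpha> u) = 0"
    unfolding eX by (simp add: prod_inner_simps e_orth_n[OF u])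
  then show "h \<alpha> a b u = h \<alpha> b a u"
    by (simp add: h_def prod_inner_simps)
qed

text \<open>Differentiating \<open>Om\<close> leaves a commutator of second derivatives, reduced by
  \<open>torsion_free\<close>, and products of first derivatives, in which
  \<open>inner_derivatives\<close> produces the determinants of \<open>h\<close> and the ambient
  term. Moving the squares of \<open>Om\<close> to the left turns that side into minus the Gauss
  curvature.\<close>

theorem gauss:
  assumes u: "u \<in> V"
  shows "D 1 (Om 2 1 2) u - D 2 (Om 1 1 2) u = - (Om 1 1 2 u)\<^sup>2 - (Om 2 1 2 u)\<^sup>2
    - (\<Sum>\<alpha>\<in>UNIV. h \<alpha> 1 1 u * h \<alpha> 2 2 u - (h \<alpha> 1 2 u)\<^sup>2) - c * (1 - (T 1 u)\<^sup>2 - (T 2 u)\<^sup>2)"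
proof -
  note diff = differentiableI[OF smooth_dirD[OF smooth_e] u] differentiableI[OF smooth_e u]
  have om0: "Om a b b u = 0" for a b using Om_skew[OF u, of a b b] by simp
  have mixed: "ip (D a (e b) u) (D d (e f) u) = (\<Sum>g\<in>UNIV. Om a b g u * Om d f g u) + (\<Sum>\<alpha>\<in>UNIV. h \<alpha> a b u * h \<alpha> d f u)
    + c * ((if b = a then 1 else 0) - T b u * T a u) * ((if f = d then 1 else 0) - T f u * T d u)" for a b d f
    by (simp add: inner_derivatives[OF u smooth_e e_tangent smooth_e e_tangent] orthonormal_e[OF u]
        flip: Om_def T_def h_def)
  have "D 1 (Om 2 1 2) u - D 2 (Om 1 1 2) u = ip (D 1 (D 2 (e 1)) u - D 2 (D 1 (e 1)) u) (e 2 u)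
    + ip (D 2 (e 1) u) (D 1 (e 2) u) - ip (D 1 (e 1) u) (D 2 (e 2) u)"
    by (simp add: Om_def[abs_def] dirD_prod_inner diff prod_inner_simps)
  also have "ip (D 1 (D 2 (e 1)) u - D 2 (D 1 (e 1)) u) (e 2 u) = (\<Sum>f\<in>UNIV. (Om 1 2 f u - Om 2 1 f u) * Om f 1 2 u)"
    by (simp add: torsion_free(1)[OF u smooth_e] prod_inner_simps Om_def)
  also have "\<dots> = - (Om 1 1 2 u)\<^sup>2 - (Om 2 1 2 u)\<^sup>2"
    using Om_skew[OF u, of 1 1 2] by (simp add: sum_2 om0 power2_eq_square)
  finally show ?thesis
    using Om_skew[OF u, of 1 1 2] Om_skew[OF u, of 2 1 2] torsion_free(2)[OF u, of _ 1 2]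
    unfolding mixed by (simp add: sum_2 om0 power2_eq_square algebra_simps)
qed

end

text \<open>With vanishing normal connection neither the derivative of \<open>\<nu>\<close> nor the
  Codazzi equation couples the two normal indices. The locale is separate because parallelism is
  itself deduced inside \<open>adapted_frame\<close>.\<close>

locale parallel_frame = adapted_frame +
  assumes n_parallel: "\<And>u a \<alpha> \<beta>. u \<in> V \<Longrightarrow> prod_inner c (dirD (E a) (n \<alpha>) u) (n \<beta> u) = 0"
begin

lemma derivative_\<nu>: "u \<in> V \<Longrightarrow> D a (\<nu> \<alpha>) u = - (\<Sum>d\<in>UNIV. h \<alpha> a d u * T d u)"
  using snd_derivative[OF _ smooth_n n_tangent]
  by (simp add: \<nu>_def[abs_def] derivative_n n_parallel sum_negf)

text \<open>The scheme of the Gauss equation with a normal vector in place of \<open>e 2\<close>.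
  The ambient term is the product of the position components of the derivatives of a tangent and a
  normal frame vector.\<close>

theorem codazzi:
  assumes u: "u \<in> V"
  shows "D a (h \<alpha> b d) u - D b (h \<alpha> a d) u =
    (\<Sum>f\<in>UNIV. (Om a b f u - Om b a f u) * h \<alpha> f d u)
    + (\<Sum>f\<in>UNIV. Om a d f u * h \<alpha> b f u - Om b d f u * h \<alpha> a f u)
    + c * \<nu> \<alpha> u * ((if a = d then T b u else 0) - (if b = d then T a u else 0))"
proof -
  note diff = differentiableI[OF smooth_dirD[OF smooth_e] u] differentiableI[OF smooth_n u]
  have mixed: "ip (D b (e d) u) (D a (n \<alpha>) u) = - (\<Sum>f\<in>UNIV. Om b d f u * h \<alpha> a f u)
      - c * ((if b = d then 1 else 0) - T d u * T b u) * (\<nu> \<alpha> u * T a u)" for a b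
    using prod_inner_commute[of c "n \<alpha> u" "e a u"]
    by (simp add: inner_derivatives[OF u smooth_e e_tangent smooth_n n_tangent] derivative_n[OF u] n_parallel[OF u]
        orthonormal_e[OF u] e_orth_n[OF u] sum_negf eq_commute[of d] flip: Om_def T_def \<nu>_def)
  have "D a (h \<alpha> b d) u - D b (h \<alpha> a d) u = ip (D a (D b (e d)) u - D b (D a (e d)) u) (n \<alpha> u)
    + ip (D b (e d) u) (D a (n \<alpha>) u) - ip (D a (e d) u) (D b (n \<alpha>) u)"
    by (simp add: h_def[abs_def] dirD_prod_inner diff prod_inner_simps)
  also have "ip (D a (D b (e d)) u - D b (D a (e d)) u) (n \<alpha> u) = (\<Sum>f\<in>UNIV. (Om a b f u - Om b a f u) * h \<alpha> f d u)"
    by (simp add: torsion_free(1)[OF u smooth_e] prod_inner_simps h_def)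
  finally show ?thesis
    unfolding mixed by (auto simp: sum_subtractf algebra_simps)
qed

end

section \<open>The Simons formula in an adapted frame\<close>

context adapted_frame
begin

definition w :: "2 \<Rightarrow> real^2 \<Rightarrow> real" where "w a = Om a 1 2"
text \<open>The trace of the Hessian in the frame: the first-order terms subtract the derivative
  along \<open>nabla_1 e_1 = w_1 e_2\<close> and \<open>nabla_2 e_2 = - w_2 e_1\<close>.\<close>

definition frame_laplacian :: "(real^2 \<Rightarrow> real) \<Rightarrow> real^2 \<Rightarrow> real" where
  "frame_laplacian F u = D 1 (D 1 F) u + D 2 (D 2 F) u - w 1 u * D 2 F u + w 2 u * D 1 F u"

text \<open>The shape operator of \<open>n \<alpha>\<close> has the matrix \<open>((p + A, B), (B, p - A))\<close>; \<open>dA\<close> and \<open>dB\<close> are the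
  components of the covariant derivative of its traceless part, corrected by the connection form \<open>w\<close>.\<close>

definition p :: "2 \<Rightarrow> real^2 \<Rightarrow> real" where "p \<alpha> u = (h \<alpha> 1 1 u + h \<alpha> 2 2 u) / 2"
definition A :: "2 \<Rightarrow> real^2 \<Rightarrow> real" where "A \<alpha> u = (h \<alpha> 1 1 u - h \<alpha> 2 2 u) / 2"
definition B :: "2 \<Rightarrow> real^2 \<Rightarrow> real" where "B \<alpha> = h \<alpha> 1 2"
definition dA :: "2 \<Rightarrow> 2 \<Rightarrow> real^2 \<Rightarrow> real" where "dA \<alpha> a u = D a (A \<alpha>) u - 2 * w a u * B \<alpha> u"
definition dB :: "2 \<Rightarrow> 2 \<Rightarrow> real^2 \<Rightarrow> real" where "dB \<alpha> a u = D a (B \<alpha>) u + 2 * w a u * A \<alpha> u"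

lemma smooth_w: "smooth_on V (w a)"
  unfolding w_def by (rule smooth_Om)

lemma smooth_A: "smooth_on V (A \<alpha>)"
  unfolding A_def[abs_def]
  by (rule smooth_on_linear[OF open_V bounded_linear_divide])
    (intro smooth_on_diff open_V smooth_h)

lemma smooth_p: "smooth_on V (p \<alpha>)"
  unfolding p_def[abs_def]
  by (rule smooth_on_linear[OF open_V bounded_linear_divide])
    (intro smooth_on_add open_V smooth_h)

lemma smooth_B: "smooth_on V (B \<alpha>)"
  unfolding B_def by (rule smooth_h)

lemma Om_eq_w:
  assumes "u \<in> V"
  shows "Om a 1 2 u = w a u" "Om a 2 1 u = - w a u" "Om a b b u = 0"
  using Om_skew[OF assms, of a 1 2] Om_skew[OF assms, of a b b] by (auto simp: w_def)

lemma h_eq: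
  assumes "u \<in> V"
  shows "h \<alpha> 1 1 u = p \<alpha> u + A \<alpha> u" "h \<alpha> 2 2 u = p \<alpha> u - A \<alpha> u" "h \<alpha> 1 2 u = B \<alpha> u" "h \<alpha> 2 1 u = B \<alpha> u"
  using torsion_free(2)[OF assms, of \<alpha> 2 1] by (auto simp: p_def A_def B_def field_simps)

lemma frame_commutator:
  fixes F :: "real^2 \<Rightarrow> real"
  assumes "u \<in> V" "smooth_on V F"
  shows "D 1 (D 2 F) u = D 2 (D 1 F) u - w 1 u * D 1 F u - w 2 u * D 2 F u"
  using torsion_free(1)[OF assms, of 1 2] Om_eq_w[OF assms(1)] by (simp add: sum_2)

end

context parallel_frame
begin

text \<open>With constant trace the two independent components of the Codazzi equation involve only
  \<open>A\<close> and \<open>B\<close>. Their left sides are also the two components of the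
  divergence of the matrix \<open>((A, B), (B, -A))\<close>.\<close>

lemma codazzi_traceless:
  assumes u: "u \<in> V" and tr: "\<And>a. D a (p \<alpha>) u = 0"
  shows "dA \<alpha> 1 u + dB \<alpha> 2 u = c * \<nu> \<alpha> u * T 1 u"
    and "dB \<alpha> 1 u - dA \<alpha> 2 u = c * \<nu> \<alpha> u * T 2 u"
proof -
  note d = differentiableI[OF smooth_p u] differentiableI[OF smooth_A u]
  have "D a (h \<alpha> 1 1) u = D a (\<lambda>q. p \<alpha> q + A \<alpha> q) u" for a
    by (rule dirD_cong_open[OF open_V u]) (rule h_eq)
  then have 1: "D a (h \<alpha> 1 1) u = D a (A \<alpha>) u" for a
    by (simp add: dirD_add d tr)
  have "D a (h \<alpha> 2 2) u = D a (\<lambda>q. p \<alpha> q - A \<alpha> q) u" for a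
    by (rule dirD_cong_open[OF open_V u]) (rule h_eq)
  then have 2: "D a (h \<alpha> 2 2) u = - D a (A \<alpha>) u" for a
    by (simp add: dirD_diff d tr)
  have 3: "D a (h \<alpha> 1 2) u = D a (B \<alpha>) u" "D a (h \<alpha> 2 1) u = D a (B \<alpha>) u" for a
    using h_eq by (auto intro: dirD_cong_open[OF open_V u])
  show "dB \<alpha> 1 u - dA \<alpha> 2 u = c * \<nu> \<alpha> u * T 2 u"
    using codazzi[OF u, of 1 \<alpha> 2 1]
    by (simp add: 1 2 3 sum_2 Om_eq_w[OF u] h_eq[OF u] dA_def dB_def algebra_simps)
  show "dA \<alpha> 1 u + dB \<alpha> 2 u = c * \<nu> \<alpha> u * T 1 u"
    using codazzi[OF u, of 1 \<alpha> 2 2]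
    by (simp add: 1 2 3 sum_2 Om_eq_w[OF u] h_eq[OF u] dA_def dB_def algebra_simps)
qed

text \<open>In dimension two the Weitzenboeck formula for traceless symmetric forms involves only the
  exterior part \<open>W\<close> of the covariant derivative, since \<open>W\<close> is also the divergence.\<close>

lemma weitzenbock:
  fixes W :: "2 \<Rightarrow> real^2 \<Rightarrow> real"
  assumes u: "u \<in> V" and sW: "\<And>a. smooth_on V (W a)"
    and W1: "\<And>q. q \<in> V \<Longrightarrow> dA \<alpha> 1 q + dB \<alpha> 2 q = W 1 q"
    and W2: "\<And>q. q \<in> V \<Longrightarrow> dB \<alpha> 1 q - dA \<alpha> 2 q = W 2 q"
  shows "frame_laplacian (\<lambda>q. 2 * ((A \<alpha> q)\<^sup>2 + (B \<alpha> q)\<^sup>2)) u / 2 =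
    2 * ((dA \<alpha> 1 u)\<^sup>2 + (dA \<alpha> 2 u)\<^sup>2 + (dB \<alpha> 1 u)\<^sup>2 + (dB \<alpha> 2 u)\<^sup>2)
    - 4 * (D 1 (w 2) u - D 2 (w 1) u + (w 1 u)\<^sup>2 + (w 2 u)\<^sup>2) * ((A \<alpha> u)\<^sup>2 + (B \<alpha> u)\<^sup>2)
    + 2 * A \<alpha> u * ((D 1 (W 1) u - w 1 u * W 2 u) - (D 2 (W 2) u + w 2 u * W 1 u))
    + 2 * B \<alpha> u * ((D 1 (W 2) u + w 1 u * W 1 u) + (D 2 (W 1) u - w 2 u * W 2 u))"
proof -
  let ?A = "A \<alpha>" and ?B = "B \<alpha>"
  note sm = smooth_w smooth_A smooth_B sW smooth_dirD[OF smooth_A] smooth_dirD[OF smooth_B]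
  note d = sm[THEN differentiableI, OF u]
  have D1: "D a (\<lambda>q. 2 * ((?A q)\<^sup>2 + (?B q)\<^sup>2)) q = 4 * (?A q * D a ?A q + ?B q * D a ?B q)"
    if "q \<in> V" for a q
    using sm[THEN differentiableI, OF that]
    by (simp add: power2_eq_square dirD_mult dirD_add algebra_simps)
  have "D a (D a (\<lambda>q. 2 * ((?A q)\<^sup>2 + (?B q)\<^sup>2))) u = D a (\<lambda>q. 4 * (?A q * D a ?A q + ?B q * D a ?B q)) u" for a
    by (rule dirD_cong_open[OF open_V u D1])
  then have D2: "D a (D a (\<lambda>q. 2 * ((?A q)\<^sup>2 + (?B q)\<^sup>2))) u =
      4 * ((D a ?A u)\<^sup>2 + (D a ?B u)\<^sup>2 + ?A u * D a (D a ?A) u + ?B u * D a (D a ?B) u)" for a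
    using d by (simp add: power2_eq_square dirD_mult dirD_add algebra_simps)
  \<comment> \<open>The first-order system is solved for each derivative in turn, so that each
    unmixed second derivative of \<open>A\<close> or \<open>B\<close> becomes a mixed one of the
    other function. In the sum these pair into commutators, which leave only first-order
    terms.\<close>
  have eqs: "D 1 ?A q = W 1 q + 2 * w 1 q * ?B q - D 2 ?B q - 2 * w 2 q * ?A q"
    "D 2 ?A q = D 1 ?B q + 2 * w 1 q * ?A q + 2 * w 2 q * ?B q - W 2 q"
    "D 1 ?B q = W 2 q - 2 * w 1 q * ?A q + D 2 ?A q - 2 * w 2 q * ?B q"
    "D 2 ?B q = W 1 q - D 1 ?A q + 2 * w 1 q * ?B q - 2 * w 2 q * ?A q"
    if "q \<in> V" for q
    using W1[OF that] W2[OF that] by (simp_all add: dA_def dB_def)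
  have cong: "D 1 (D 1 ?A) u = D 1 (\<lambda>q. W 1 q + 2 * w 1 q * ?B q - D 2 ?B q - 2 * w 2 q * ?A q) u"
    "D 2 (D 2 ?A) u = D 2 (\<lambda>q. D 1 ?B q + 2 * w 1 q * ?A q + 2 * w 2 q * ?B q - W 2 q) u"
    "D 1 (D 1 ?B) u = D 1 (\<lambda>q. W 2 q - 2 * w 1 q * ?A q + D 2 ?A q - 2 * w 2 q * ?B q) u"
    "D 2 (D 2 ?B) u = D 2 (\<lambda>q. W 1 q - D 1 ?A q + 2 * w 1 q * ?B q - 2 * w 2 q * ?A q) u"
    by (rule dirD_cong_open[OF open_V u], rule eqs, assumption)+
  have 11: "D 1 (D 1 ?A) u = D 1 (W 1) u + 2 * (D 1 (w 1) u * ?B u + w 1 u * D 1 ?B u) - D 1 (D 2 ?B) u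
      - 2 * (D 1 (w 2) u * ?A u + w 2 u * D 1 ?A u)"
    unfolding cong(1) using d by (simp add: dirD_mult dirD_add dirD_diff)
  have 22: "D 2 (D 2 ?A) u = D 2 (D 1 ?B) u + 2 * (D 2 (w 1) u * ?A u + w 1 u * D 2 ?A u)
      + 2 * (D 2 (w 2) u * ?B u + w 2 u * D 2 ?B u) - D 2 (W 2) u"
    unfolding cong(2) using d by (simp add: dirD_mult dirD_add dirD_diff)
  have 33: "D 1 (D 1 ?B) u = D 1 (W 2) u - 2 * (D 1 (w 1) u * ?A u + w 1 u * D 1 ?A u) + D 1 (D 2 ?A) u
      - 2 * (D 1 (w 2) u * ?B u + w 2 u * D 1 ?B u)"
    unfolding cong(3) using d by (simp add: dirD_mult dirD_add dirD_diff)
  have 44: "D 2 (D 2 ?B) u = D 2 (W 1) u - D 2 (D 1 ?A) u + 2 * (D 2 (w 1) u * ?B u + w 1 u * D 2 ?B u)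
      - 2 * (D 2 (w 2) u * ?A u + w 2 u * D 2 ?A u)"
    unfolding cong(4) using d by (simp add: dirD_mult dirD_add dirD_diff)
  note comm = frame_commutator[OF u smooth_A, of \<alpha>] frame_commutator[OF u smooth_B, of \<alpha>]
  have W: "W 1 u = dA \<alpha> 1 u + dB \<alpha> 2 u" "W 2 u = dB \<alpha> 1 u - dA \<alpha> 2 u"
    using W1[OF u] W2[OF u] by auto
  show ?thesis
    unfolding frame_laplacian_def D1[OF u] D2 11 22 33 44 comm W dA_def dB_def
    by (simp add: power2_eq_square algebra_simps add_divide_distrib diff_divide_distrib)
qed

text \<open>Formulated for any parallel normal frame with constant traces, so both normal directions
  enter symmetrically and \<open>|H|^2\<close> appears as the sum of the squares of
  \<open>p \<alpha>\<close>.\<close>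

theorem simons_frame:
  assumes u: "u \<in> V" and tr: "\<And>\<alpha> a q. q \<in> V \<Longrightarrow> D a (p \<alpha>) q = 0"
  defines "Q \<equiv> \<lambda>q. \<Sum>\<alpha>\<in>UNIV. 2 * ((A \<alpha> q)\<^sup>2 + (B \<alpha> q)\<^sup>2)"
  shows "frame_laplacian Q u / 2 =
    (\<Sum>\<alpha>\<in>UNIV. 2 * ((dA \<alpha> 1 u)\<^sup>2 + (dA \<alpha> 2 u)\<^sup>2 + (dB \<alpha> 1 u)\<^sup>2 + (dB \<alpha> 2 u)\<^sup>2))
    - (Q u)\<^sup>2 + (c * (2 - 3 * ((T 1 u)\<^sup>2 + (T 2 u)\<^sup>2)) + 2 * (\<Sum>\<alpha>\<in>UNIV. (p \<alpha> u)\<^sup>2)) * Q u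
    - 2 * c * (\<Sum>\<alpha>\<in>UNIV. p \<alpha> u * (A \<alpha> u * ((T 1 u)\<^sup>2 - (T 2 u)\<^sup>2) + 2 * B \<alpha> u * T 1 u * T 2 u))
    + 2 * c * (2 * ((\<Sum>\<alpha>\<in>UNIV. \<nu> \<alpha> u * A \<alpha> u)\<^sup>2 + (\<Sum>\<alpha>\<in>UNIV. \<nu> \<alpha> u * B \<alpha> u)\<^sup>2))"
proof -
  let ?f = "\<lambda>\<alpha> q. 2 * ((A \<alpha> q)\<^sup>2 + (B \<alpha> q)\<^sup>2)"
  define W where "W \<alpha> a q = c * \<nu> \<alpha> q * T a q" for \<alpha> a q
  have sf: "smooth_on V (?f \<alpha>)" for \<alpha>
    by (intro smooth_on_mult smooth_on_add smooth_on_power2 smooth_on_const smooth_A smooth_B open_V)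
  have sW: "smooth_on V (W \<alpha> a)" for \<alpha> a
    unfolding W_def[abs_def] by (intro smooth_on_mult smooth_on_const smooth_\<nu> smooth_T open_V)
  have Qsum: "D a Q q = (\<Sum>\<alpha>\<in>UNIV. D a (?f \<alpha>) q)" if "q \<in> V" for a q
    unfolding Q_def using differentiableI[OF sf that] by (intro dirD_sum) auto
  have "D a (D a Q) u = D a (\<lambda>q. \<Sum>\<alpha>\<in>UNIV. D a (?f \<alpha>) q) u" for a
    by (rule dirD_cong_open[OF open_V u Qsum])
  then have "D a (D a Q) u = (\<Sum>\<alpha>\<in>UNIV. D a (D a (?f \<alpha>)) u)" for a
    using differentiableI[OF smooth_dirD[OF sf] u] by (simp add: dirD_sum)
  then have lapQ: "frame_laplacian Q u = (\<Sum>\<alpha>\<in>UNIV. frame_laplacian (?f \<alpha>) u)"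
    by (simp add: frame_laplacian_def Qsum[OF u] sum_2 algebra_simps)
  have DW: "D a (W \<alpha> b) u = c * (D a (\<nu> \<alpha>) u * T b u + \<nu> \<alpha> u * D a (T b) u)" for a b \<alpha>
    unfolding W_def[abs_def]
    using differentiableI[OF smooth_\<nu> u] differentiableI[OF smooth_T u]
    by (simp add: mult.assoc dirD_mult)
  have wb: "frame_laplacian (?f \<alpha>) u / 2 =
    2 * ((dA \<alpha> 1 u)\<^sup>2 + (dA \<alpha> 2 u)\<^sup>2 + (dB \<alpha> 1 u)\<^sup>2 + (dB \<alpha> 2 u)\<^sup>2)
    - 4 * (D 1 (w 2) u - D 2 (w 1) u + (w 1 u)\<^sup>2 + (w 2 u)\<^sup>2) * ((A \<alpha> u)\<^sup>2 + (B \<alpha> u)\<^sup>2)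
    + 2 * A \<alpha> u * ((D 1 (W \<alpha> 1) u - w 1 u * W \<alpha> 2 u) - (D 2 (W \<alpha> 2) u + w 2 u * W \<alpha> 1 u))
    + 2 * B \<alpha> u * ((D 1 (W \<alpha> 2) u + w 1 u * W \<alpha> 1 u) + (D 2 (W \<alpha> 1) u - w 2 u * W \<alpha> 2 u))" for \<alpha>
    using codazzi_traceless[OF _ tr] by (intro weitzenbock[OF u sW]) (simp_all add: W_def)
  \<comment> \<open>The left side is minus the Gauss curvature; each determinant of \<open>h\<close>
    is \<open>p^2 - A^2 - B^2\<close>.\<close>
  have curv: "D 1 (w 2) u - D 2 (w 1) u + (w 1 u)\<^sup>2 + (w 2 u)\<^sup>2 =
      - (\<Sum>\<alpha>\<in>UNIV. (p \<alpha> u)\<^sup>2 - (A \<alpha> u)\<^sup>2 - (B \<alpha> u)\<^sup>2) - c * (1 - (T 1 u)\<^sup>2 - (T 2 u)\<^sup>2)"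
    using gauss[OF u] by (simp add: w_def h_eq[OF u] flip: w_def) (simp add: power2_eq_square algebra_simps)
  have DT: "D 1 (T 1) u = w 1 u * T 2 u + (\<Sum>\<alpha>\<in>UNIV. (p \<alpha> u + A \<alpha> u) * \<nu> \<alpha> u)"
    "D 2 (T 2) u = - w 2 u * T 1 u + (\<Sum>\<alpha>\<in>UNIV. (p \<alpha> u - A \<alpha> u) * \<nu> \<alpha> u)"
    "D 1 (T 2) u = - w 1 u * T 1 u + (\<Sum>\<alpha>\<in>UNIV. B \<alpha> u * \<nu> \<alpha> u)"
    "D 2 (T 1) u = w 2 u * T 2 u + (\<Sum>\<alpha>\<in>UNIV. B \<alpha> u * \<nu> \<alpha> u)"
    by (simp_all add: derivative_T[OF u] sum_2 Om_eq_w[OF u] h_eq[OF u])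
  have D\<nu>: "D 1 (\<nu> \<alpha>) u = - ((p \<alpha> u + A \<alpha> u) * T 1 u + B \<alpha> u * T 2 u)"
    "D 2 (\<nu> \<alpha>) u = - (B \<alpha> u * T 1 u + (p \<alpha> u - A \<alpha> u) * T 2 u)" for \<alpha>
    by (simp_all add: derivative_\<nu>[OF u] sum_2 h_eq[OF u])
  have "frame_laplacian Q u / 2 = (\<Sum>\<alpha>\<in>UNIV. frame_laplacian (?f \<alpha>) u / 2)"
    by (simp add: lapQ sum_divide_distrib)
  then show ?thesis
    unfolding wb curv DW DT D\<nu> W_def Q_def sum_2
    by (simp add: power2_eq_square algebra_simps)
qed

end

section \<open>From coordinates to the frame\<close>

lemma matrix_inv_eqI:
  fixes M :: "'a::semiring_1^'n^'n"
  assumes "M ** N = mat 1" and "N ** M = mat 1"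
  shows "matrix_inv M = N"
proof -
  have "M ** matrix_inv M = mat 1 \<and> matrix_inv M ** M = mat 1"
    unfolding matrix_inv_def
    by (rule someI[of "\<lambda>N. M ** N = mat 1 \<and> N ** M = mat 1" N]) (use assms in simp)
  then show ?thesis
    using assms by (metis matrix_mul_assoc matrix_mul_lid matrix_mul_rid)
qed

lemma partial_cong_open:
  "open U \<Longrightarrow> u \<in> U \<Longrightarrow> (\<And>p. p \<in> U \<Longrightarrow> F p = G p) \<Longrightarrow> partial i F u = partial i G u"
  unfolding partial_eq_dirD by (rule dirD_cong_open)

context adapted_frame
begin

abbreviation dX :: "2 \<Rightarrow> real^2 \<Rightarrow> amb" where "dX i \<equiv> partial i X"
abbreviation ddX :: "2 \<Rightarrow> 2 \<Rightarrow> real^2 \<Rightarrow> amb" where "ddX i j \<equiv> partial i (partial j X)"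
text \<open>The dual coframe evaluated on the coordinate fields; as a matrix it is inverse to the
  components of \<open>E\<close>.\<close>

definition \<theta> :: "2 \<Rightarrow> 2 \<Rightarrow> real^2 \<Rightarrow> real" where "\<theta> d j u = ip (e d u) (dX j u)"

lemmas smooth_dX = smooth_on_partial[OF smooth_X]

lemma smooth_\<theta>: "smooth_on V (\<theta> d j)"
  unfolding \<theta>_def[abs_def] by (intro smooth_ip smooth_e smooth_dX)

lemma smooth_E_nth: "smooth_on V (\<lambda>q. E a q $ i)"
  by (rule smooth_on_nth[OF open_V smooth_E])

lemma e_eq: "u \<in> V \<Longrightarrow> e d u = (\<Sum>i\<in>UNIV. E d u $ i *\<^sub>R dX i u)"
  by (rule dirD_eq_partial[OF differentiableI[OF smooth_X]])

lemma coordinates_frame: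
  assumes u: "u \<in> V"
  shows dX_eq: "dX j u = (\<Sum>d\<in>UNIV. \<theta> d j u *\<^sub>R e d u)"
    and E_\<theta>: "(\<Sum>d\<in>UNIV. E d u $ i * \<theta> d j u) = (if i = j then 1 else 0)"
    and \<theta>_E: "(\<Sum>i\<in>UNIV. \<theta> a i u * E b u $ i) = (if a = b then 1 else 0)"
proof -
  obtain \<kappa> where \<kappa>: "axis j 1 = (\<Sum>d\<in>UNIV. \<kappa> d *\<^sub>R E d u)"
    using frame_span[OF u] .
  note lin = linear_frechet_derivative[OF differentiableI[OF smooth_X u]]
  have dX: "dX j u = (\<Sum>d\<in>UNIV. \<kappa> d *\<^sub>R e d u)"
    unfolding partial_def \<kappa> by (simp add: linear_sum[OF lin] linear_cmul[OF lin] dirD_def)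
  have \<theta>: "\<theta> d j u = \<kappa> d" for d
    unfolding \<theta>_def dX by (simp add: prod_inner_simps orthonormal_e[OF u] mult_delta_left mult_delta_right)
  show "dX j u = (\<Sum>d\<in>UNIV. \<theta> d j u *\<^sub>R e d u)" using dX by (simp add: \<theta>)
  show "(\<Sum>d\<in>UNIV. E d u $ i * \<theta> d j u) = (if i = j then 1 else 0)"
    using arg_cong[OF \<kappa>, of "\<lambda>v. v $ i"] by (simp add: \<theta> mult.commute) (auto simp: axis_def)
  show "(\<Sum>i\<in>UNIV. \<theta> a i u * E b u $ i) = (if a = b then 1 else 0)"
    using orthonormal_e[OF u, of a b] e_eq[OF u, of b]
    by (simp add: prod_inner_simps \<theta>_def mult.commute)
qed

lemma metric_eq: "u \<in> V \<Longrightarrow> metric c X u $ i $ j = (\<Sum>d\<in>UNIV. \<theta> d i u * \<theta> d j u)"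
proof -
  assume u: "u \<in> V"
  have "ip (dX i u) (dX j u) = ip (\<Sum>d\<in>UNIV. \<theta> d i u *\<^sub>R e d u) (dX j u)"
    by (simp only: dX_eq[OF u, of i])
  then show ?thesis by (simp add: metric_def prod_inner_simps \<theta>_def)
qed

text \<open>The metric is the transpose of \<open>\<theta>\<close> times \<open>\<theta>\<close>, so
  its inverse is built in the same way from the matrix inverse to \<open>\<theta>\<close>.\<close>

lemma metric_inv_eq:
  assumes u: "u \<in> V"
  shows "metric_inv c X u $ i $ j = (\<Sum>d\<in>UNIV. E d u $ i * E d u $ j)"
proof -
  have sym: "(\<Sum>d\<in>UNIV. \<theta> d i u * E d u $ j) = (if i = j then 1 else 0)" for i j
    using E_\<theta>[OF u, of j i] by (simp add: mult.commute)
  have 1: "(\<Sum>k\<in>UNIV. (\<Sum>d\<in>UNIV. E d u $ i * E d u $ k) * (\<Sum>f\<in>UNIV. \<theta> f k u * \<theta> f j u)) = (if i = j then 1 else 0)" for i j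
  proof -
    have "(\<Sum>k\<in>UNIV. (\<Sum>d\<in>UNIV. E d u $ i * E d u $ k) * (\<Sum>f\<in>UNIV. \<theta> f k u * \<theta> f j u)) =
      (\<Sum>d\<in>UNIV. \<Sum>f\<in>UNIV. (\<Sum>k\<in>UNIV. \<theta> f k u * E d u $ k) * (E d u $ i * \<theta> f j u))"
      by (simp add: sum_2 algebra_simps)
    then show ?thesis
      using E_\<theta>[OF u, of i j] by (simp add: \<theta>_E[OF u] mult_delta_left mult_delta_right)
  qed
  have 2: "(\<Sum>k\<in>UNIV. (\<Sum>f\<in>UNIV. \<theta> f i u * \<theta> f k u) * (\<Sum>d\<in>UNIV. E d u $ k * E d u $ j)) = (if i = j then 1 else 0)" for i j
  proof -
    have "(\<Sum>k\<in>UNIV. (\<Sum>f\<in>UNIV. \<theta> f i u * \<theta> f k u) * (\<Sum>d\<in>UNIV. E d u $ k * E d u $ j)) =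
      (\<Sum>d\<in>UNIV. \<Sum>f\<in>UNIV. (\<Sum>k\<in>UNIV. \<theta> f k u * E d u $ k) * (E d u $ j * \<theta> f i u))"
      by (simp add: sum_2 algebra_simps)
    then show ?thesis
      using E_\<theta>[OF u, of j i] by (auto simp: \<theta>_E[OF u] mult_delta_left mult_delta_right)
  qed
  have "matrix_inv (metric c X u) = (\<chi> i j. \<Sum>d\<in>UNIV. E d u $ i * E d u $ j)"
    by (rule matrix_inv_eqI; simp add: vec_eq_iff matrix_matrix_mult_def mat_def metric_eq[OF u] 1 2)
  then show ?thesis by (simp add: metric_inv_def)
qed

section \<open>Second fundamental form and mean curvature in the frame\<close>

lemma raise_index:
  "u \<in> V \<Longrightarrow> (\<Sum>j\<in>UNIV. metric_inv c X u $ i $ j * ip v (dX j u)) = (\<Sum>d\<in>UNIV. E d u $ i * ip v (e d u))"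
  by (simp add: metric_inv_eq e_eq prod_inner_simps sum_2 algebra_simps)

lemma tan_coords_eq: "u \<in> V \<Longrightarrow> tan_coords c X u v $ i = (\<Sum>d\<in>UNIV. E d u $ i * ip v (e d u))"
  using raise_index[of u i v] by (simp add: tan_coords_def matrix_vector_mult_def)

lemma tan_part_eq: "u \<in> V \<Longrightarrow> tan_part c X u v = (\<Sum>d\<in>UNIV. ip v (e d u) *\<^sub>R e d u)"
  by (simp add: tan_part_def tan_coords_eq e_eq sum_2 algebra_simps)

lemma nor_part_eq:
  assumes "u \<in> V" and "v \<in> prod_tangent c (X u)"
  shows "nor_part c X u v = (\<Sum>\<alpha>\<in>UNIV. ip v (n \<alpha> u) *\<^sub>R n \<alpha> u)"
  using tangent_expansion[OF assms] by (simp add: nor_part_def tan_part_eq[OF assms(1)] algebra_simps)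

lemma nor_part_conn:
  assumes "u \<in> V" and "smooth_on V W" and "\<And>q. q \<in> V \<Longrightarrow> W q \<in> prod_tangent c (X q)"
  shows "nor_part c X u (prod_conn c X i W u) = (\<Sum>\<alpha>\<in>UNIV. ip (partial i W u) (n \<alpha> u) *\<^sub>R n \<alpha> u)"
proof -
  have "prod_conn c X i W u \<in> prod_tangent c (X u)"
    using conn_prod_tangent[OF open_V smooth_X X_in assms(2,3,1)]
    by (simp add: prod_conn_def partial_eq_dirD)
  then show ?thesis
    by (simp add: nor_part_eq[OF assms(1)] prod_conn_def ip_position[OF assms(1) n_tangent[OF assms(1)]]
        del: scaleR_Pair)
qed

text \<open>The second fundamental form in coordinates, as opposed to \<open>h\<close> in the
  frame.\<close>

definition hc :: "2 \<Rightarrow> 2 \<Rightarrow> 2 \<Rightarrow> real^2 \<Rightarrow> real" where "hc \<alpha> i j u = ip (ddX i j u) (n \<alpha> u)"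

lemma dX_tangent: "u \<in> V \<Longrightarrow> dX i u \<in> prod_tangent c (X u)"
  unfolding partial_eq_dirD by (rule dirD_prod_tangent[OF open_V smooth_X X_in])

lemma second_form_eq: "u \<in> V \<Longrightarrow> second_form c X i j u = (\<Sum>\<alpha>\<in>UNIV. hc \<alpha> i j u *\<^sub>R n \<alpha> u)"
  unfolding second_form_def hc_def by (rule nor_part_conn[OF _ smooth_dX dX_tangent])

lemma dX_orth_n: "u \<in> V \<Longrightarrow> ip (dX i u) (n \<alpha> u) = 0"
  by (simp add: dX_eq prod_inner_simps e_orth_n)

text \<open>Differentiating the coefficients of the frame contributes only multiples of the
  coordinate fields, which are orthogonal to the normals.\<close>

lemma h_eq_hc:
  assumes "u \<in> V"
  shows "h \<alpha> a b u = (\<Sum>i\<in>UNIV. \<Sum>j\<in>UNIV. E a u $ i * E b u $ j * hc \<alpha> i j u)"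
  using dX_orth_n[OF assms]
  by (simp add: h_def hc_def dirD_dirD[OF open_V assms smooth_E smooth_X] prod_inner_simps)

lemma hc_eq_h:
  assumes u: "u \<in> V"
  shows "hc \<alpha> i j u = (\<Sum>a\<in>UNIV. \<Sum>b\<in>UNIV. h \<alpha> a b u * \<theta> a i u * \<theta> b j u)"
proof -
  have "(\<Sum>a\<in>UNIV. \<Sum>b\<in>UNIV. h \<alpha> a b u * \<theta> a i u * \<theta> b j u) =
    (\<Sum>k\<in>UNIV. \<Sum>l\<in>UNIV. (\<Sum>a\<in>UNIV. E a u $ k * \<theta> a i u) * (\<Sum>b\<in>UNIV. E b u $ l * \<theta> b j u) * hc \<alpha> k l u)"
    by (simp add: h_eq_hc[OF u] sum_2 algebra_simps)
  then show ?thesis by (simp add: E_\<theta>[OF u] mult_delta_left mult_delta_right)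
qed

lemma mean_curvature_eq:
  assumes u: "u \<in> V"
  shows "mean_curvature c X u = (\<Sum>\<alpha>\<in>UNIV. p \<alpha> u *\<^sub>R n \<alpha> u)"
proof -
  have peq: "p \<alpha> u = (\<Sum>i\<in>UNIV. \<Sum>j\<in>UNIV. metric_inv c X u $ i $ j * hc \<alpha> i j u) / 2" for \<alpha>
    by (simp add: p_def h_eq_hc[OF u] metric_inv_eq[OF u] sum_2 algebra_simps)
  show ?thesis
    unfolding mean_curvature_def second_form_eq[OF u] peq
    by (simp add: sum_2 algebra_simps add_divide_distrib)
qed

definition ph :: "2 \<Rightarrow> 2 \<Rightarrow> 2 \<Rightarrow> real^2 \<Rightarrow> real" where
  "ph \<alpha> a b u = h \<alpha> a b u - (if a = b then p \<alpha> u else 0)"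

lemma ph_eq:
  assumes "u \<in> V"
  shows "ph \<alpha> 1 1 u = A \<alpha> u" "ph \<alpha> 2 2 u = - A \<alpha> u" "ph \<alpha> 1 2 u = B \<alpha> u" "ph \<alpha> 2 1 u = B \<alpha> u"
  using h_eq[OF assms] by (simp_all add: ph_def)

lemma smooth_ph: "smooth_on V (ph \<alpha> a b)"
  unfolding ph_def[abs_def]
  by (cases "a = b") (auto intro!: smooth_on_diff open_V smooth_h smooth_p smooth_on_const)

lemma phi_form_eq:
  assumes u: "u \<in> V"
  shows "phi_form c X i j u = (\<Sum>\<alpha>\<in>UNIV. (\<Sum>a\<in>UNIV. \<Sum>b\<in>UNIV. ph \<alpha> a b u * \<theta> a i u * \<theta> b j u) *\<^sub>R n \<alpha> u)"
  by (simp add: phi_form_def second_form_eq[OF u] mean_curvature_eq[OF u] hc_eq_h[OF u] metric_eq[OF u]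
      ph_def sum_2 algebra_simps)

lemma phi_norm_sq_eq:
  assumes u: "u \<in> V"
  shows "phi_norm_sq c X u = (\<Sum>\<alpha>\<in>UNIV. 2 * ((A \<alpha> u)\<^sup>2 + (B \<alpha> u)\<^sup>2))"
proof -
  define S where "S \<alpha> i j = (\<Sum>a\<in>UNIV. \<Sum>b\<in>UNIV. ph \<alpha> a b u * \<theta> a i u * \<theta> b j u)" for \<alpha> i j
  have ipphi: "ip (phi_form c X i j u) (phi_form c X k l u) = (\<Sum>\<alpha>\<in>UNIV. S \<alpha> i j * S \<alpha> k l)" for i j k l
    by (simp add: phi_form_eq[OF u] prod_inner_simps orthonormal_n[OF u] S_def mult.commute mult_delta_left mult_delta_right)
  have fr: "(\<Sum>i\<in>UNIV. \<Sum>j\<in>UNIV. E a u $ i * E b u $ j * S \<alpha> i j) = ph \<alpha> a b u" for \<alpha> a b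
  proof -
    have "(\<Sum>i\<in>UNIV. \<Sum>j\<in>UNIV. E a u $ i * E b u $ j * S \<alpha> i j) =
      (\<Sum>f\<in>UNIV. \<Sum>g\<in>UNIV. (\<Sum>i\<in>UNIV. \<theta> f i u * E a u $ i) * (\<Sum>j\<in>UNIV. \<theta> g j u * E b u $ j) * ph \<alpha> f g u)"
      by (simp add: S_def sum_2 algebra_simps)
    then show ?thesis by (simp add: \<theta>_E[OF u] mult_delta_left mult_delta_right)
  qed
  \<comment> \<open>Each inverse metric splits as a sum over the frame, so a full contraction
    becomes a sum of squares of frame components.\<close>
  have contr: "(\<Sum>i\<in>UNIV. \<Sum>j\<in>UNIV. \<Sum>k\<in>UNIV. \<Sum>l\<in>UNIV. metric_inv c X u $ i $ k * metric_inv c X u $ j $ l * (R i j * R k l)) =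
    (\<Sum>a\<in>UNIV. \<Sum>b\<in>UNIV. (\<Sum>i\<in>UNIV. \<Sum>j\<in>UNIV. E a u $ i * E b u $ j * R i j)\<^sup>2)" for R :: "2 \<Rightarrow> 2 \<Rightarrow> real"
    by (simp add: metric_inv_eq[OF u] sum_2 power2_eq_square algebra_simps)
  have "phi_norm_sq c X u = (\<Sum>\<alpha>\<in>UNIV. \<Sum>i\<in>UNIV. \<Sum>j\<in>UNIV. \<Sum>k\<in>UNIV. \<Sum>l\<in>UNIV.
      metric_inv c X u $ i $ k * metric_inv c X u $ j $ l * (S \<alpha> i j * S \<alpha> k l))"
    by (simp add: phi_norm_sq_def ipphi sum_2 algebra_simps)
  then show ?thesis
    unfolding contr fr by (simp add: sum_2 ph_eq[OF u] power2_eq_square)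
qed

section \<open>Christoffel symbols, covariant derivatives and the Laplacian in the frame\<close>

lemma partial_ip:
  assumes "u \<in> V" "smooth_on V F" "smooth_on V G"
  shows "partial i (\<lambda>q. ip (F q) (G q)) u = ip (partial i F u) (G u) + ip (F u) (partial i G u)"
  unfolding partial_eq_dirD
  by (rule dirD_prod_inner[OF differentiableI[OF assms(2,1)] differentiableI[OF assms(3,1)]])

text \<open>In the Koszul combination of derivatives of the metric all but one product cancel by
  symmetry of second derivatives: the Christoffel symbols are the tangential components of the flat
  second derivative of \<open>X\<close>.\<close>

lemma christoffel_eq:
  assumes u: "u \<in> V"
  shows "christoffel c X k i j u = (\<Sum>d\<in>UNIV. E d u $ k * ip (ddX i j u) (e d u))"
proof -
  have dg: "partial i (\<lambda>q. metric c X q $ j $ m) u = ip (ddX i j u) (dX m u) + ip (dX j u) (ddX i m u)" for i j m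
    by (simp add: metric_def partial_ip[OF u smooth_dX smooth_dX])
  note sym = partial_commute[OF open_V smooth_X u]
  have "(partial i (\<lambda>v. metric c X v $ j $ m) u + partial j (\<lambda>v. metric c X v $ i $ m) u
        - partial m (\<lambda>v. metric c X v $ i $ j) u) = 2 * ip (ddX i j u) (dX m u)" for m
    unfolding dg sym[of j i] sym[of m i] sym[of m j]
    by (simp add: prod_inner_commute[of c "dX j u"] prod_inner_commute[of c "dX i u"])
  then show ?thesis
    using raise_index[OF u, of k "ddX i j u"]
    by (simp add: christoffel_def sum_distrib_left mult.left_commute[of 2])
qed

lemma partial_e:
  assumes u: "u \<in> V"
  shows "partial k (e a) u = (\<Sum>l\<in>UNIV. partial k (\<lambda>q. E a q $ l) u *\<^sub>R dX l u + E a u $ l *\<^sub>R ddX k l u)"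
proof -
  have "partial k (e a) u = partial k (\<lambda>q. \<Sum>l\<in>UNIV. E a q $ l *\<^sub>R dX l q) u"
    using e_eq by (rule partial_cong_open[OF open_V u])
  also have "\<dots> = (\<Sum>l\<in>UNIV. partial k (\<lambda>q. E a q $ l *\<^sub>R dX l q) u)"
    using differentiableI[OF smooth_on_scaleR[OF open_V smooth_E_nth smooth_dX] u]
    unfolding partial_eq_dirD[of k] by (intro dirD_sum) auto
  also have "\<dots> = (\<Sum>l\<in>UNIV. partial k (\<lambda>q. E a q $ l) u *\<^sub>R dX l u + E a u $ l *\<^sub>R ddX k l u)"
    unfolding partial_eq_dirD[of k]
    using dirD_scaleR[OF differentiableI[OF smooth_E_nth u] differentiableI[OF smooth_dX u]] by simp
  finally show ?thesis .
qed

definition om :: "2 \<Rightarrow> 2 \<Rightarrow> 2 \<Rightarrow> real^2 \<Rightarrow> real" where "om k a b u = ip (partial k (e a) u) (e b u)"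

lemma Om_eq_om: "u \<in> V \<Longrightarrow> Om a b d u = (\<Sum>k\<in>UNIV. E a u $ k * om k b d u)"
  by (simp add: Om_def om_def dirD_eq_partial[OF differentiableI[OF smooth_e]] prod_inner_simps)

text \<open>This is \<open>nabla_k E_a = om_k E\<close> in coordinates, read off from the tangential
  part of the derivative of \<open>e a\<close>; \<open>partial_\<theta>\<close> is the dual
  statement for the coframe.\<close>

lemma partial_E:
  assumes u: "u \<in> V"
  shows "partial k (\<lambda>q. E a q $ i) u =
    (\<Sum>f\<in>UNIV. om k a f u * E f u $ i) - (\<Sum>l\<in>UNIV. christoffel c X i k l u * E a u $ l)"
proof -
  have "om k a f u = (\<Sum>l\<in>UNIV. partial k (\<lambda>q. E a q $ l) u * \<theta> f l u + E a u $ l * ip (ddX k l u) (e f u))" for f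
    using prod_inner_commute[of c "e f u"]
    by (simp add: om_def partial_e[OF u] prod_inner_simps \<theta>_def)
  then have "(\<Sum>f\<in>UNIV. om k a f u * E f u $ i) =
      (\<Sum>l\<in>UNIV. (\<Sum>f\<in>UNIV. E f u $ i * \<theta> f l u) * partial k (\<lambda>q. E a q $ l) u)
      + (\<Sum>l\<in>UNIV. christoffel c X i k l u * E a u $ l)"
    by (simp add: christoffel_eq[OF u] sum_2 algebra_simps)
  then show ?thesis by (simp add: E_\<theta>[OF u] mult_delta_left mult_delta_right)
qed

lemma partial_\<theta>:
  assumes u: "u \<in> V"
  shows "partial k (\<theta> b j) u = (\<Sum>f\<in>UNIV. om k b f u * \<theta> f j u) + (\<Sum>l\<in>UNIV. christoffel c X l k j u * \<theta> b l u)"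
proof -
  have "partial k (\<theta> b j) u = ip (partial k (e b) u) (dX j u) + ip (e b u) (ddX k j u)"
    unfolding \<theta>_def[abs_def] by (rule partial_ip[OF u smooth_e smooth_dX])
  also have "ip (partial k (e b) u) (dX j u) = (\<Sum>f\<in>UNIV. om k b f u * \<theta> f j u)"
    by (subst dX_eq[OF u]) (simp add: prod_inner_simps om_def mult.commute)
  also have "ip (e b u) (ddX k j u) = (\<Sum>l\<in>UNIV. christoffel c X l k j u * \<theta> b l u)"
  proof -
    have "(\<Sum>l\<in>UNIV. christoffel c X l k j u * \<theta> b l u) =
      (\<Sum>d\<in>UNIV. (\<Sum>l\<in>UNIV. \<theta> b l u * E d u $ l) * ip (ddX k j u) (e d u))"
      by (simp add: christoffel_eq[OF u] sum_2 algebra_simps)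
    then show ?thesis
      by (simp add: \<theta>_E[OF u] prod_inner_commute[of c "e b u"] mult_delta_left mult_delta_right)
  qed
  finally show ?thesis .
qed

lemma op_inner_frame:
  assumes u: "u \<in> V"
    and M: "\<And>i j. M $ i $ j = (\<Sum>a\<in>UNIV. \<Sum>b\<in>UNIV. r a b * E a u $ i * \<theta> b j u)"
    and N: "\<And>i j. N $ i $ j = (\<Sum>a\<in>UNIV. \<Sum>b\<in>UNIV. s a b * E a u $ i * \<theta> b j u)"
  shows "op_inner c X u M N = (\<Sum>a\<in>UNIV. \<Sum>b\<in>UNIV. r a b * s a b)"
proof -
  have comp: "(\<Sum>i\<in>UNIV. \<Sum>j\<in>UNIV. \<theta> a i u * E b u $ j * M $ i $ j) = r a b"
    if "\<And>i j. M $ i $ j = (\<Sum>a\<in>UNIV. \<Sum>b\<in>UNIV. r a b * E a u $ i * \<theta> b j u)" for a b r and M :: "real^2^2"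
  proof -
    have "(\<Sum>i\<in>UNIV. \<Sum>j\<in>UNIV. \<theta> a i u * E b u $ j * M $ i $ j) =
      (\<Sum>f\<in>UNIV. \<Sum>g\<in>UNIV. (\<Sum>i\<in>UNIV. \<theta> a i u * E f u $ i) * (\<Sum>j\<in>UNIV. \<theta> g j u * E b u $ j) * r f g)"
      by (simp add: that sum_2 algebra_simps)
    then show ?thesis by (simp add: \<theta>_E[OF u] mult_delta_left mult_delta_right)
  qed
  have "op_inner c X u M N = (\<Sum>a\<in>UNIV. \<Sum>b\<in>UNIV. (\<Sum>i\<in>UNIV. \<Sum>j\<in>UNIV. \<theta> a i u * E b u $ j * M $ i $ j)
      * (\<Sum>i\<in>UNIV. \<Sum>j\<in>UNIV. \<theta> a i u * E b u $ j * N $ i $ j))"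
    by (simp add: op_inner_def metric_eq[OF u] metric_inv_eq[OF u] sum_2 algebra_simps)
  then show ?thesis using comp[OF M] comp[OF N] by simp
qed

text \<open>The Christoffel symbols produced by differentiating \<open>E\<close> and
  \<open>\<theta>\<close> cancel those in \<open>nabla_op\<close>; only the connection form of the
  frame survives.\<close>

lemma nabla_op_frame:
  assumes u: "u \<in> V" and s: "\<And>a b. smooth_on V (s a b)"
    and M: "\<And>q i j. q \<in> V \<Longrightarrow> M q $ i $ j = (\<Sum>a\<in>UNIV. \<Sum>b\<in>UNIV. s a b q * E a q $ i * \<theta> b j q)"
  shows "nabla_op c X k M u $ i $ j = (\<Sum>a\<in>UNIV. \<Sum>b\<in>UNIV.
    (partial k (s a b) u + (\<Sum>f\<in>UNIV. s f b u * om k f a u + s a f u * om k f b u)) * E a u $ i * \<theta> b j u)"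
proof -
  note d = s[THEN differentiableI, OF u] differentiableI[OF smooth_E_nth u] differentiableI[OF smooth_\<theta> u]
  have "partial k (\<lambda>q. M q $ i $ j) u = partial k (\<lambda>q. \<Sum>a\<in>UNIV. \<Sum>b\<in>UNIV. s a b q * E a q $ i * \<theta> b j q) u"
    using M by (rule partial_cong_open[OF open_V u])
  also have "\<dots> = (\<Sum>a\<in>UNIV. \<Sum>b\<in>UNIV. partial k (s a b) u * E a u $ i * \<theta> b j u
      + s a b u * partial k (\<lambda>q. E a q $ i) u * \<theta> b j u + s a b u * E a u $ i * partial k (\<theta> b j) u)"
    unfolding partial_eq_dirD using d by (simp add: dirD_sum dirD_mult algebra_simps)
  finally show ?thesis
    by (simp add: nabla_op_def M[OF u] partial_E[OF u] partial_\<theta>[OF u] sum_2 algebra_simps)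
qed

lemma nabla_norm_sq_frame:
  assumes u: "u \<in> V" and s: "\<And>a b. smooth_on V (s a b)"
    and M: "\<And>q i j. q \<in> V \<Longrightarrow> M q $ i $ j = (\<Sum>a\<in>UNIV. \<Sum>b\<in>UNIV. s a b q * E a q $ i * \<theta> b j q)"
  shows "nabla_norm_sq c X M u = (\<Sum>d\<in>UNIV. \<Sum>a\<in>UNIV. \<Sum>b\<in>UNIV.
    (D d (s a b) u + (\<Sum>f\<in>UNIV. s f b u * Om d f a u + s a f u * Om d f b u))\<^sup>2)"
proof -
  define N where "N k a b = partial k (s a b) u + (\<Sum>f\<in>UNIV. s f b u * om k f a u + s a f u * om k f b u)" for k a b
  have "D d (s a b) u + (\<Sum>f\<in>UNIV. s f b u * Om d f a u + s a f u * Om d f b u) = (\<Sum>k\<in>UNIV. E d u $ k * N k a b)" for d a b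
    by (simp add: N_def Om_eq_om[OF u] dirD_eq_partial[OF differentiableI[OF s u]] sum_2 algebra_simps)
  moreover have "nabla_norm_sq c X M u = (\<Sum>k\<in>UNIV. \<Sum>l\<in>UNIV. metric_inv c X u $ k $ l * (\<Sum>a\<in>UNIV. \<Sum>b\<in>UNIV. N k a b * N l a b))"
    unfolding nabla_norm_sq_def N_def
    by (intro sum.cong refl arg_cong2[where f = "(*)"] op_inner_frame[OF u] nabla_op_frame[OF u s M])
  ultimately show ?thesis
    by (simp add: metric_inv_eq[OF u] sum_2 power2_eq_square algebra_simps)
qed

text \<open>Differentiating \<open>E a\<close> along itself gives \<open>nabla_a e_a\<close> minus a
  Christoffel term; the former is the first-order part of \<open>frame_laplacian\<close>, the latter
  that of the coordinate Laplacian.\<close>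

lemma laplacian_frame:
  assumes u: "u \<in> V" and F: "smooth_on V F"
  shows "laplacian c X F u = frame_laplacian F u"
proof -
  have DE: "dirD (E a) (E a) u $ k = (\<Sum>f\<in>UNIV. Om a a f u * E f u $ k)
      - (\<Sum>i\<in>UNIV. \<Sum>j\<in>UNIV. E a u $ i * E a u $ j * christoffel c X k i j u)" for a k
  proof -
    have "dirD (E a) (E a) u $ k = (\<Sum>i\<in>UNIV. E a u $ i * partial i (\<lambda>q. E a q $ k) u)"
      using dirD_linear[OF bounded_linear_vec_nth differentiableI[OF smooth_E u]]
        dirD_eq_partial[OF differentiableI[OF smooth_E_nth u]] by (metis (no_types, lifting) real_scaleR_def sum.cong)
    then show ?thesis
      by (simp add: partial_E[OF u] Om_eq_om[OF u] sum_2 algebra_simps)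
  qed
  show ?thesis
    unfolding frame_laplacian_def dirD_dirD[OF open_V u smooth_E F] DE
    by (simp add: laplacian_def metric_inv_eq[OF u] sum_2 Om_eq_w[OF u]
        dirD_eq_partial[OF differentiableI[OF F u]] algebra_simps)
qed

end

section \<open>Parallel mean curvature\<close>

text \<open>Explicit formulas make smoothness a matter of closure rules. The immersion condition and
  positivity on tangent spaces keep the denominators positive.\<close>

lemma gram_schmidt_frame:
  assumes V: "open V" and X: "smooth_on V X" "\<And>u. u \<in> V \<Longrightarrow> X u \<in> space_form c \<times> UNIV"
    and imm: "\<And>u. u \<in> V \<Longrightarrow> inj (frechet_derivative X (at u))"
  obtains E :: "2 \<Rightarrow> real^2 \<Rightarrow> real^2"
  where "\<And>a. smooth_on V (E a)"
    and "\<And>u a b. u \<in> V \<Longrightarrow> prod_inner c (dirD (E a) X u) (dirD (E b) X u) = (if a = b then 1 else 0)"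
proof -
  define g where "g i j u = prod_inner c (partial i X u) (partial j X u)" for i j u
  define \<Delta> where "\<Delta> u = g 1 1 u * g 2 2 u - (g 1 2 u)\<^sup>2" for u
  have sm: "smooth_on V (g i j)" for i j
    unfolding g_def[abs_def]
    by (intro smooth_on_bilinear[OF V bounded_bilinear_prod_inner] smooth_on_partial X(1))
  have sym: "g 2 1 u = g 1 2 u" for u by (simp add: g_def prod_inner_commute)
  have pos: "prod_inner c (r *\<^sub>R partial 1 X u + s *\<^sub>R partial 2 X u) (r *\<^sub>R partial 1 X u + s *\<^sub>R partial 2 X u) > 0"
    if u: "u \<in> V" and rs: "r \<noteq> 0 \<or> s \<noteq> 0" for r s u
  proof -
    note lin = linear_frechet_derivative[OF smooth_on_differentiable[OF X(1) u]]
    let ?k = "r *\<^sub>R axis 1 1 + s *\<^sub>R axis 2 1 :: real^2"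
    have "?k $ 1 = r" "?k $ 2 = s" by (simp_all add: axis_def)
    then have "?k \<noteq> 0" using rs by (metis zero_index)
    then have "frechet_derivative X (at u) ?k \<noteq> 0"
      using imm[OF u] linear_0[OF lin] by (metis injD)
    moreover have dk: "frechet_derivative X (at u) ?k = r *\<^sub>R partial 1 X u + s *\<^sub>R partial 2 X u"
      by (simp add: linear_add[OF lin] linear_cmul[OF lin] partial_def)
    moreover have "frechet_derivative X (at u) ?k \<in> prod_tangent c (X u)"
      using dirD_prod_tangent[OF V X u, of "\<lambda>_. ?k"] by (simp add: dirD_def)
    ultimately show ?thesis using prod_inner_pos_tangent[OF X(2)[OF u]] by simp
  qed
  have g11: "g 1 1 u > 0" if "u \<in> V" for u
    using pos[OF that, of 1 0] by (simp add: g_def)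
  have \<Delta>: "\<Delta> u > 0" if "u \<in> V" for u
  proof -
    have "prod_inner c (- g 1 2 u *\<^sub>R partial 1 X u + g 1 1 u *\<^sub>R partial 2 X u)
        (- g 1 2 u *\<^sub>R partial 1 X u + g 1 1 u *\<^sub>R partial 2 X u) = g 1 1 u * \<Delta> u"
      using sym[of u] unfolding \<Delta>_def
      by (simp add: prod_inner_simps flip: g_def) (simp add: power2_eq_square algebra_simps)
    then show ?thesis
      using pos[OF that, of "- g 1 2 u" "g 1 1 u"] g11[OF that] by (simp add: zero_less_mult_iff)
  qed
  define \<rho> where "\<rho> u = inverse (sqrt (g 1 1 u))" for u
  \<comment> \<open>\<open>g 1 1 u * \<Delta> u\<close> is the squared length of
    \<open>- g_12 dX_1 + g_11 dX_2\<close>, the combination orthogonal to the first coordinate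
    field.\<close>
  define \<rho>' where "\<rho>' u = inverse (sqrt (g 1 1 u * \<Delta> u))" for u
  define E :: "2 \<Rightarrow> real^2 \<Rightarrow> real^2" where
    "E a u = (if a = 1 then \<rho> u *\<^sub>R axis 1 1 else (\<rho>' u * - g 1 2 u) *\<^sub>R axis 1 1 + (\<rho>' u * g 1 1 u) *\<^sub>R axis 2 1)" for a u
  have s\<Delta>: "smooth_on V \<Delta>"
    unfolding \<Delta>_def[abs_def] by (intro smooth_on_diff smooth_on_mult smooth_on_power2 sm V)
  have s\<rho>: "smooth_on V \<rho>"
    unfolding \<rho>_def[abs_def] using g11
    by (intro smooth_on_inverse smooth_on_sqrt sm V) force+
  have s\<rho>': "smooth_on V \<rho>'"
    unfolding \<rho>'_def[abs_def] using g11 \<Delta>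
    by (intro smooth_on_inverse smooth_on_sqrt smooth_on_mult sm s\<Delta> V) force+
  have sE: "smooth_on V (E a)" for a
  proof (cases "a = 1")
    case True
    then show ?thesis
      unfolding E_def[abs_def] by (simp add: smooth_on_scaleR V s\<rho> smooth_on_const)
  next
    case False
    then have "E a = (\<lambda>u. (\<rho>' u * - g 1 2 u) *\<^sub>R axis 1 1 + (\<rho>' u * g 1 1 u) *\<^sub>R axis 2 1)"
      by (simp add: E_def fun_eq_iff)
    then show ?thesis
      by (auto intro!: smooth_on_diff smooth_on_scaleR smooth_on_mult smooth_on_uminus smooth_on_const V s\<rho>' sm)
  qed
  have on: "prod_inner c (dirD (E a) X u) (dirD (E b) X u) = (if a = b then 1 else 0)" if u: "u \<in> V" for u a b
  proof -
    note lin = linear_frechet_derivative[OF smooth_on_differentiable[OF X(1) u]]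
    have ne: "(2::2) \<noteq> 1" by simp
    have e1: "dirD (E 1) X u = \<rho> u *\<^sub>R partial 1 X u"
      by (simp add: dirD_def E_def linear_cmul[OF lin] partial_def)
    have e2: "dirD (E 2) X u = (\<rho>' u * - g 1 2 u) *\<^sub>R partial 1 X u + (\<rho>' u * g 1 1 u) *\<^sub>R partial 2 X u"
      using ne by (simp add: dirD_def E_def linear_add[OF lin] linear_diff[OF lin] linear_cmul[OF lin] linear_neg[OF lin] partial_def)
    have r: "\<rho> u * \<rho> u * g 1 1 u = 1" "\<rho>' u * \<rho>' u * (g 1 1 u * \<Delta> u) = 1"
      using g11[OF u] \<Delta>[OF u] unfolding \<rho>_def \<rho>'_def by (simp_all add: field_simps)
    have "prod_inner c (dirD (E 1) X u) (dirD (E 1) X u) = \<rho> u * \<rho> u * g 1 1 u"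
      by (simp add: e1 prod_inner_simps flip: g_def)
    moreover have "prod_inner c (dirD (E 2) X u) (dirD (E 2) X u) = \<rho>' u * \<rho>' u * (g 1 1 u * \<Delta> u)"
      unfolding e2 \<Delta>_def using sym[of u]
      by (simp add: prod_inner_simps flip: g_def) (simp add: power2_eq_square algebra_simps)
    moreover have "prod_inner c (dirD (E 1) X u) (dirD (E 2) X u) = 0"
      unfolding e1 e2 by (simp add: prod_inner_simps flip: g_def)
    moreover have "prod_inner c (dirD (E 2) X u) (dirD (E 1) X u) = 0"
      using calculation(3) by (simp add: prod_inner_commute)
    ultimately show ?thesis using r exhaust_2[of a] exhaust_2[of b] by auto
  qed
  show thesis using that sE on by blast
qed

text \<open>The frame expression of the squared norm is available only on \<open>V\<close>; the
  Laplacian is local, so this is enough.\<close>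

lemma laplacian_cong_open:
  assumes "open V" and "u \<in> V" and "\<And>q. q \<in> V \<Longrightarrow> F q = G q"
  shows "laplacian c X F u = laplacian c X G u"
proof -
  have "partial j F q = partial j G q" if "q \<in> V" for j q
    using assms(3) by (rule partial_cong_open[OF assms(1) that])
  moreover from this have "partial i (partial j F) u = partial i (partial j G) u" for i j
    by (rule partial_cong_open[OF assms(1,2)])
  ultimately show ?thesis using assms(2) by (simp add: laplacian_def)
qed

section \<open>Shape operators, the components of \<open>xi\<close>, and parallel normal
  frames\<close>

context adapted_frame
begin

text \<open>A common form for \<open>phi3\<close> and \<open>phi4\<close>: once \<open>H\<close>
  points along \<open>n 1\<close>, the trace part for the second index vanishes.\<close>

definition Phi :: "2 \<Rightarrow> real^2 \<Rightarrow> real^2^2" where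
  "Phi \<alpha> u = shape_op c X u (n \<alpha> u) - p \<alpha> u *\<^sub>R mat 1"

lemma shape_op_frame:
  assumes u: "u \<in> V"
  shows "shape_op c X u (n \<alpha> u) $ i $ j = (\<Sum>a\<in>UNIV. \<Sum>b\<in>UNIV. h \<alpha> a b u * E a u $ i * \<theta> b j u)"
proof -
  have "ip (second_form c X j k u) (n \<alpha> u) = hc \<alpha> j k u" for j k
    by (simp add: second_form_eq[OF u] prod_inner_simps orthonormal_n[OF u] mult_delta_right)
  then have "shape_op c X u (n \<alpha> u) $ i $ j = (\<Sum>k\<in>UNIV. metric_inv c X u $ i $ k * hc \<alpha> j k u)"
    by (simp add: shape_op_def matrix_matrix_mult_def)
  also have "\<dots> = (\<Sum>d\<in>UNIV. \<Sum>a\<in>UNIV. \<Sum>b\<in>UNIV. (\<Sum>k\<in>UNIV. \<theta> b k u * E d u $ k) * (h \<alpha> a b u * E d u $ i * \<theta> a j u))"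
    by (simp add: metric_inv_eq[OF u] hc_eq_h[OF u] sum_2 algebra_simps)
  also have "\<dots> = (\<Sum>d\<in>UNIV. \<Sum>a\<in>UNIV. h \<alpha> d a u * E d u $ i * \<theta> a j u)"
    using torsion_free(2)[OF u, of \<alpha>] by (simp add: \<theta>_E[OF u] mult_delta_left)
  finally show ?thesis .
qed

lemma mat_1_frame:
  "u \<in> V \<Longrightarrow> (mat 1 :: real^2^2) $ i $ j = (\<Sum>a\<in>UNIV. \<Sum>b\<in>UNIV. (if a = b then 1 else 0) * E a u $ i * \<theta> b j u)"
  using E_\<theta>[of u i j] by (simp add: mat_def mult_delta_left)

lemma Phi_frame:
  assumes u: "u \<in> V"
  shows "Phi \<alpha> u $ i $ j = (\<Sum>a\<in>UNIV. \<Sum>b\<in>UNIV. ph \<alpha> a b u * E a u $ i * \<theta> b j u)"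
  by (simp add: Phi_def shape_op_frame[OF u] mat_1_frame[OF u] ph_def sum_2 algebra_simps)

text \<open>The factor 2 counts the entries \<open>A, B, B, -A\<close>. The field \<open>M\<close>
  is free outside \<open>V\<close> because \<open>phi3\<close> and \<open>phi4\<close> are
  identified with \<open>Phi\<close> on \<open>V\<close> only.\<close>

lemma nabla_norm_sq_Phi:
  assumes u: "u \<in> V" and M: "\<And>q. q \<in> V \<Longrightarrow> M q = Phi \<alpha> q"
  shows "nabla_norm_sq c X M u = 2 * ((dA \<alpha> 1 u)\<^sup>2 + (dA \<alpha> 2 u)\<^sup>2 + (dB \<alpha> 1 u)\<^sup>2 + (dB \<alpha> 2 u)\<^sup>2)"
proof -
  have d: "D d (ph \<alpha> 1 1) u = D d (A \<alpha>) u" "D d (ph \<alpha> 1 2) u = D d (B \<alpha>) u"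
    "D d (ph \<alpha> 2 1) u = D d (B \<alpha>) u" "D d (ph \<alpha> 2 2) u = D d (\<lambda>q. - A \<alpha> q) u" for d
    by (rule dirD_cong_open[OF open_V u], simp add: ph_eq)+
  have "nabla_norm_sq c X M u = (\<Sum>d\<in>UNIV. \<Sum>a\<in>UNIV. \<Sum>b\<in>UNIV.
    (D d (ph \<alpha> a b) u + (\<Sum>f\<in>UNIV. ph \<alpha> f b u * Om d f a u + ph \<alpha> a f u * Om d f b u))\<^sup>2)"
    using Phi_frame M by (intro nabla_norm_sq_frame[OF u smooth_ph]) simp
  then show ?thesis
    by (simp add: sum_2 d ph_eq[OF u] Om_eq_w[OF u] dirD_uminus differentiableI[OF smooth_A u] dA_def dB_def
        power2_eq_square algebra_simps)
qed

lemma op_norm_sq_Phi: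
  assumes u: "u \<in> V"
  shows "op_norm_sq c X u (\<Sum>\<alpha>\<in>UNIV. r \<alpha> *\<^sub>R Phi \<alpha> u) =
    2 * ((\<Sum>\<alpha>\<in>UNIV. r \<alpha> * A \<alpha> u)\<^sup>2 + (\<Sum>\<alpha>\<in>UNIV. r \<alpha> * B \<alpha> u)\<^sup>2)"
proof -
  have "(\<Sum>\<alpha>\<in>UNIV. r \<alpha> *\<^sub>R Phi \<alpha> u) $ i $ j =
    (\<Sum>a\<in>UNIV. \<Sum>b\<in>UNIV. (\<Sum>\<alpha>\<in>UNIV. r \<alpha> * ph \<alpha> a b u) * E a u $ i * \<theta> b j u)" for i j
    by (simp add: Phi_frame[OF u] sum_2 algebra_simps)
  then have "op_norm_sq c X u (\<Sum>\<alpha>\<in>UNIV. r \<alpha> *\<^sub>R Phi \<alpha> u) = (\<Sum>a\<in>UNIV. \<Sum>b\<in>UNIV. (\<Sum>\<alpha>\<in>UNIV. r \<alpha> * ph \<alpha> a b u) * (\<Sum>\<alpha>\<in>UNIV. r \<alpha> * ph \<alpha> a b u))"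
    unfolding op_norm_sq_def by (intro op_inner_frame[OF u])
  then show ?thesis
    by (simp add: sum_2 ph_eq[OF u] power2_eq_square algebra_simps)
qed

lemma nor_part_xi: "u \<in> V \<Longrightarrow> nor_part c X u xi = (\<Sum>\<alpha>\<in>UNIV. \<nu> \<alpha> u *\<^sub>R n \<alpha> u)"
  by (simp add: nor_part_eq xi_prod_tangent prod_inner_xi \<nu>_def)

text \<open>Trace and traceless parts are orthogonal, and the identity of a plane has squared norm
  2.\<close>

lemma op_norm_sq_shape_op:
  assumes u: "u \<in> V"
  shows "op_norm_sq c X u (shape_op c X u (\<Sum>\<alpha>\<in>UNIV. r \<alpha> *\<^sub>R n \<alpha> u)) =
    2 * ((\<Sum>\<alpha>\<in>UNIV. r \<alpha> * A \<alpha> u)\<^sup>2 + (\<Sum>\<alpha>\<in>UNIV. r \<alpha> * B \<alpha> u)\<^sup>2) + 2 * (\<Sum>\<alpha>\<in>UNIV. r \<alpha> * p \<alpha> u)\<^sup>2"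
proof -
  have "shape_op c X u (\<Sum>\<alpha>\<in>UNIV. r \<alpha> *\<^sub>R n \<alpha> u) $ i $ j = (\<Sum>\<alpha>\<in>UNIV. r \<alpha> * shape_op c X u (n \<alpha> u) $ i $ j)" for i j
    by (simp add: shape_op_def matrix_matrix_mult_def prod_inner_simps sum_2 algebra_simps)
  then have "shape_op c X u (\<Sum>\<alpha>\<in>UNIV. r \<alpha> *\<^sub>R n \<alpha> u) $ i $ j =
    (\<Sum>a\<in>UNIV. \<Sum>b\<in>UNIV. (\<Sum>\<alpha>\<in>UNIV. r \<alpha> * h \<alpha> a b u) * E a u $ i * \<theta> b j u)" for i j
    by (simp add: shape_op_frame[OF u] sum_2 algebra_simps)
  then have "op_norm_sq c X u (shape_op c X u (\<Sum>\<alpha>\<in>UNIV. r \<alpha> *\<^sub>R n \<alpha> u)) =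
    (\<Sum>a\<in>UNIV. \<Sum>b\<in>UNIV. (\<Sum>\<alpha>\<in>UNIV. r \<alpha> * h \<alpha> a b u) * (\<Sum>\<alpha>\<in>UNIV. r \<alpha> * h \<alpha> a b u))"
    unfolding op_norm_sq_def by (intro op_inner_frame[OF u])
  then show ?thesis
    by (simp add: sum_2 h_eq[OF u] power2_eq_square algebra_simps)
qed

lemma tan_part_xi_norm: "u \<in> V \<Longrightarrow> (prod_norm c (tan_part c X u xi))\<^sup>2 = (T 1 u)\<^sup>2 + (T 2 u)\<^sup>2"
proof -
  assume u: "u \<in> V"
  have "ip (tan_part c X u xi) (tan_part c X u xi) = (T 1 u)\<^sup>2 + (T 2 u)\<^sup>2"
    by (simp add: tan_part_eq[OF u] prod_inner_xi prod_inner_simps orthonormal_e[OF u] mult_delta_right sum_2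
        power2_eq_square T_def)
  then show ?thesis by (simp add: prod_norm_def)
qed

text \<open>Each coefficient is the quadratic form of \<open>((A, B), (B, -A))\<close> at
  \<open>T\<close>; the work lies in the passage from coordinates.\<close>

lemma phi_form_T:
  assumes u: "u \<in> V"
  shows "(\<Sum>i\<in>UNIV. \<Sum>j\<in>UNIV. (tan_coords c X u xi $ i * tan_coords c X u xi $ j) *\<^sub>R phi_form c X i j u) =
    (\<Sum>\<alpha>\<in>UNIV. (A \<alpha> u * ((T 1 u)\<^sup>2 - (T 2 u)\<^sup>2) + 2 * B \<alpha> u * T 1 u * T 2 u) *\<^sub>R n \<alpha> u)"
proof -
  have tc: "tan_coords c X u xi $ i = (\<Sum>d\<in>UNIV. E d u $ i * T d u)" for i
    by (simp add: tan_coords_eq[OF u] prod_inner_xi T_def)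
  have "(\<Sum>i\<in>UNIV. \<theta> a i u * tan_coords c X u xi $ i) = (\<Sum>d\<in>UNIV. (\<Sum>i\<in>UNIV. \<theta> a i u * E d u $ i) * T d u)" for a
    by (simp add: tc sum_2 algebra_simps)
  then have \<theta>t: "(\<Sum>i\<in>UNIV. \<theta> a i u * tan_coords c X u xi $ i) = T a u" for a
    by (simp add: \<theta>_E[OF u] mult_delta_left)
  define S where "S \<alpha> i j = (\<Sum>a\<in>UNIV. \<Sum>b\<in>UNIV. ph \<alpha> a b u * \<theta> a i u * \<theta> b j u)" for \<alpha> i j
  have coeff: "(\<Sum>i\<in>UNIV. \<Sum>j\<in>UNIV. tan_coords c X u xi $ i * tan_coords c X u xi $ j * S \<alpha> i j) =
    (\<Sum>a\<in>UNIV. \<Sum>b\<in>UNIV. ph \<alpha> a b u * (\<Sum>i\<in>UNIV. \<theta> a i u * tan_coords c X u xi $ i)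
      * (\<Sum>i\<in>UNIV. \<theta> b i u * tan_coords c X u xi $ i))" for \<alpha>
    by (simp add: S_def sum_2 algebra_simps)
  have "(\<Sum>i\<in>UNIV. \<Sum>j\<in>UNIV. (tan_coords c X u xi $ i * tan_coords c X u xi $ j) *\<^sub>R phi_form c X i j u) =
    (\<Sum>\<alpha>\<in>UNIV. (\<Sum>i\<in>UNIV. \<Sum>j\<in>UNIV. tan_coords c X u xi $ i * tan_coords c X u xi $ j * S \<alpha> i j) *\<^sub>R n \<alpha> u)"
    unfolding phi_form_eq[OF u] S_def[symmetric] by (simp add: sum_2 algebra_simps)
  also have "\<dots> = (\<Sum>\<alpha>\<in>UNIV. (A \<alpha> u * ((T 1 u)\<^sup>2 - (T 2 u)\<^sup>2) + 2 * B \<alpha> u * T 1 u * T 2 u) *\<^sub>R n \<alpha> u)"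
    unfolding coeff \<theta>t
    by (intro sum.cong refl arg_cong2[where f = scaleR])
      (simp add: sum_2 ph_eq[OF u] power2_eq_square algebra_simps)
  finally show ?thesis .
qed

lemma pmc_parallel:
  assumes n1: "\<And>q. q \<in> V \<Longrightarrow> n 1 q = E3 c X q"
    and H: "\<And>q. q \<in> V \<Longrightarrow> mean_curvature c X q \<noteq> 0"
    and pmc: "\<And>q i. q \<in> V \<Longrightarrow> normal_conn c X i (mean_curvature c X) q = 0"
    and u: "u \<in> V"
  shows "p 1 u = prod_norm c (mean_curvature c X u)" "p 2 u = 0" "D a (p \<alpha>) u = 0"
    and "ip (D a (n \<alpha>) u) (n \<beta> u) = 0"
proof -
  have ne: "(2::2) \<noteq> 1" "(1::2) \<noteq> 2" by simp_all
  have pn: "p 1 q = prod_norm c (mean_curvature c X q) \<and> p 2 q = 0 \<and> p 1 q > 0" if q: "q \<in> V" for q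
  proof -
    let ?H = "mean_curvature c X q"
    have "?H \<in> prod_tangent c (X q)"
      unfolding mean_curvature_eq[OF q]
      by (intro subspace_sum[OF subspace_prod_tangent] subspace_scale[OF subspace_prod_tangent] n_tangent q)
    then have pos: "prod_norm c ?H > 0"
      using prod_inner_pos_tangent[OF X_in[OF q] _ H[OF q]] by (simp add: prod_norm_def)
    then have "?H = prod_norm c ?H *\<^sub>R n 1 q" by (simp add: n1[OF q] E3_def)
    then have "ip ?H (n \<alpha> q) = prod_norm c ?H * ip (n 1 q) (n \<alpha> q)" for \<alpha>
      by (metis prod_inner.scaleR_left real_scaleR_def)
    moreover have "ip ?H (n \<alpha> q) = p \<alpha> q" for \<alpha>
      by (simp add: mean_curvature_eq[OF q] prod_inner_simps orthonormal_n[OF q] mult_delta_right)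
    ultimately show ?thesis using pos ne by (simp add: orthonormal_n[OF q])
  qed
  show "p 1 u = prod_norm c (mean_curvature c X u)" "p 2 u = 0" using pn[OF u] by auto
  have diff: "p \<alpha> differentiable (at u)" "n \<alpha> differentiable (at u)" for \<alpha>
    using differentiableI smooth_p smooth_n u by blast+
  have skew: "ip (D a (n \<alpha>) u) (n \<beta> u) + ip (D a (n \<beta>) u) (n \<alpha> u) = 0" for a \<alpha> \<beta>
  proof -
    have "D a (\<lambda>q. ip (n \<alpha> q) (n \<beta> q)) u = D a (\<lambda>_. if \<alpha> = \<beta> then 1 else 0) u"
      using orthonormal_n by (intro dirD_cong_open[OF open_V u]) simp
    then show ?thesis
      by (simp add: dirD_prod_inner diff prod_inner_commute[of c "n \<alpha> u"])
  qed
  have Hn: "mean_curvature c X q = p 1 q *\<^sub>R n 1 q" if "q \<in> V" for q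
    using pn[OF that] by (simp add: mean_curvature_eq[OF that] sum_2)
  have sH: "smooth_on V (mean_curvature c X)"
    by (rule smooth_on_cong[OF open_V Hn, THEN iffD2]) (auto intro: smooth_on_scaleR open_V smooth_p smooth_n)
  have tH: "mean_curvature c X q \<in> prod_tangent c (X q)" if "q \<in> V" for q
    unfolding Hn[OF that] by (intro subspace_scale[OF subspace_prod_tangent] n_tangent that)
  have "ip (partial i (mean_curvature c X) u) (n \<beta> u) = 0" for i \<beta>
  proof -
    have "(\<Sum>\<alpha>\<in>UNIV. ip (partial i (mean_curvature c X) u) (n \<alpha> u) *\<^sub>R n \<alpha> u) = 0"
      using pmc[OF u, of i] by (simp add: normal_conn_def nor_part_conn[OF u sH tH])
    then have "ip (\<Sum>\<alpha>\<in>UNIV. ip (partial i (mean_curvature c X) u) (n \<alpha> u) *\<^sub>R n \<alpha> u) (n \<beta> u) = 0"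
      by (simp only: prod_inner.zero_left)
    then show ?thesis by (simp add: prod_inner_simps orthonormal_n[OF u] mult_delta_right)
  qed
  then have "ip (D a (mean_curvature c X) u) (n \<beta> u) = 0" for a \<beta>
    by (simp add: dirD_eq_partial[OF differentiableI[OF sH u]] prod_inner_simps)
  moreover have "D a (mean_curvature c X) u = D a (\<lambda>q. p 1 q *\<^sub>R n 1 q) u" for a
    using Hn by (rule dirD_cong_open[OF open_V u])
  ultimately have "D a (p 1) u * ip (n 1 u) (n \<beta> u) + p 1 u * ip (D a (n 1) u) (n \<beta> u) = 0" for a \<beta>
    by (simp add: dirD_scaleR diff prod_inner_simps)
  \<comment> \<open>Pairing the derivative of \<open>H = p 1 n 1\<close> with \<open>n 1\<close>
    gives constant length, and pairing with \<open>n 2\<close> kills the one independent normal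
    connection coefficient, as \<open>p 1\<close> is positive.\<close>
  from this[of _ 1] this[of _ 2] have
    dp1: "D a (p 1) u = 0" and n12: "ip (D a (n 1) u) (n 2 u) = 0" for a
    using skew[of _ 1 1] pn[OF u] ne by (auto simp: orthonormal_n[OF u])
  have "D a (p 2) u = D a (\<lambda>_. 0) u" for a
    using pn by (intro dirD_cong_open[OF open_V u]) simp
  then show "D a (p \<alpha>) u = 0" using dp1 exhaust_2[of \<alpha>] by auto
  show "ip (D a (n \<alpha>) u) (n \<beta> u) = 0"
    using n12 skew[of a 1 1] skew[of a 2 2] skew[of a 1 2] exhaust_2[of \<alpha>] exhaust_2[of \<beta>] by auto
qed

end

theorem proposition4p1:
  fixes c :: real and S :: "'a topology" and \<A> :: "'a atlas" and f :: "'a \<Rightarrow> amb"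
    and U V :: "(real^2) set" and x :: "real^2 \<Rightarrow> 'a" and E4 :: "real^2 \<Rightarrow> amb" and u :: "real^2"
  assumes "immersed_surface c S \<A> f"
    and "pmc c \<A> f"
    and "non_minimal c \<A> f"
    and "(U, x) \<in> \<A>"
    and "open V" and "V \<subseteq> U"
    and "orthonormal_normal_frame c (f \<circ> x) V (E3 c (f \<circ> x)) E4"
    and "u \<in> V"
  shows
    "let X = f \<circ> x;
         H = mean_curvature c X u;
         T = tan_part c X u xi;
         T' = tan_coords c X u xi;
         N = nor_part c X u xi;
         \<phi>TT = (\<Sum>i\<in>UNIV. \<Sum>j\<in>UNIV. (T' $ i * T' $ j) *\<^sub>R phi_form c X i j u);
         \<nu>3 = prod_inner c xi (E3 c X u);
         \<nu>4 = prod_inner c xi (E4 u);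
         common = nabla_norm_sq c X (phi3 c X) u + nabla_norm_sq c X (phi4 c X E4) u
           - (phi_norm_sq c X u)\<^sup>2
           + (c * (2 - 3 * (prod_norm c T)\<^sup>2) + 2 * (prod_norm c H)\<^sup>2) * phi_norm_sq c X u
           - 2 * c * prod_inner c \<phi>TT H
     in (1/2) * laplacian c X (phi_norm_sq c X) u =
          common + 2 * c * op_norm_sq c X u (\<nu>3 *\<^sub>R phi3 c X u + \<nu>4 *\<^sub>R phi4 c X E4 u)
      \<and> (1/2) * laplacian c X (phi_norm_sq c X) u =
          common + 2 * c * op_norm_sq c X u (shape_op c X u N) - 4 * c * (prod_inner c H N)\<^sup>2"
proof -
  define X where "X = f \<circ> x"
  have V: "open V" and u: "u \<in> V" by fact+
  have surf: "smooth_surface S \<A>" "\<And>p. p \<in> topspace S \<Longrightarrow> f p \<in> space_form c \<times> UNIV"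
    "smooth_on U X" "\<And>q. q \<in> U \<Longrightarrow> inj (frechet_derivative X (at q))"
    using assms(1,4) unfolding immersed_surface_def X_def by auto
  have "x q \<in> topspace S" if "q \<in> U" for q
    using surf(1) assms(4) that unfolding smooth_surface_def by auto
  then have X_in: "X q \<in> space_form c \<times> UNIV" if "q \<in> V" for q
    using surf(2) that \<open>V \<subseteq> U\<close> unfolding X_def by auto
  have smX: "smooth_on V X" using smooth_on_subset[OF surf(3) \<open>V \<subseteq> U\<close>] .
  have imm: "inj (frechet_derivative X (at q))" if "q \<in> V" for q
    using surf(4) that \<open>V \<subseteq> U\<close> by auto
  obtain E :: "2 \<Rightarrow> real^2 \<Rightarrow> real^2" where E: "\<And>a. smooth_on V (E a)"
    "\<And>u a b. u \<in> V \<Longrightarrow> prod_inner c (dirD (E a) X u) (dirD (E b) X u) = (if a = b then 1 else 0)"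
    using gram_schmidt_frame[OF V smX X_in imm] by metis
  define n :: "2 \<Rightarrow> real^2 \<Rightarrow> amb" where "n \<alpha> = (if \<alpha> = 1 then E3 c X else E4)" for \<alpha>
  have n12: "n 1 = E3 c X" "n 2 = E4" by (simp_all add: n_def)
  have fr: "smooth_on V (E3 c X)" "smooth_on V E4"
    "\<And>q. q \<in> V \<Longrightarrow> E3 c X q \<in> prod_tangent c (X q) \<and> E4 q \<in> prod_tangent c (X q) \<and>
        (\<forall>i. prod_inner c (E3 c X q) (partial i X q) = 0 \<and> prod_inner c (E4 q) (partial i X q) = 0) \<and>
        prod_inner c (E3 c X q) (E3 c X q) = 1 \<and> prod_inner c (E4 q) (E4 q) = 1 \<and>
        prod_inner c (E3 c X q) (E4 q) = 0"
    using assms(7) unfolding orthonormal_normal_frame_def X_def by auto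
  have dX_n: "prod_inner c (partial i X q) (n \<alpha> q) = 0" if "q \<in> V" for i \<alpha> q
    using fr(3)[OF that] by (simp add: n_def prod_inner_commute[of c "partial i X q"])
  interpret adapted_frame c X V E n
  proof
    fix q :: "real^2" and a \<alpha> \<beta> :: 2
    assume q: "q \<in> V"
    show "n \<alpha> q \<in> prod_tangent c (X q)" using fr(3)[OF q] by (simp add: n_def)
    show "prod_inner c (n \<alpha> q) (n \<beta> q) = (if \<alpha> = \<beta> then 1 else 0)"
      using fr(3)[OF q] prod_inner_commute[of c "E4 q" "E3 c X q"] exhaust_2[of \<alpha>] exhaust_2[of \<beta>]
      by (auto simp: n_def)
    show "prod_inner c (dirD (E a) X q) (n \<alpha> q) = 0"
      using dX_n[OF q] by (simp add: dirD_eq_partial[OF smooth_on_differentiable[OF smX q]] prod_inner_simps)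
  qed (use V smX X_in E fr in \<open>auto simp: n_def\<close>)
  have H: "mean_curvature c X q \<noteq> 0" and par: "normal_conn c X i (mean_curvature c X) q = 0"
    if "q \<in> V" for q i
    using bspec[OF assms(2)[unfolded pmc_def] assms(4)] bspec[OF assms(3)[unfolded non_minimal_def] assms(4)]
      that \<open>V \<subseteq> U\<close> unfolding X_def by auto
  have pp: "p 1 q = prod_norm c (mean_curvature c X q)" "p 2 q = 0" "D a (p \<alpha>) q = 0"
    "prod_inner c (D a (n \<alpha>) q) (n \<beta> q) = 0" if "q \<in> V" for q a \<alpha> \<beta>
    by (rule pmc_parallel[OF _ H par that]; simp add: n12)+
  \<comment> \<open>The parallelism needed here was deduced within the weaker locale, whence two
    interpretations.\<close>
  interpret parallel_frame c X V E n
    by unfold_locales (rule pp(4))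
  have phi3: "phi3 c X q = Phi 1 q" and phi4: "phi4 c X E4 q = Phi 2 q" if "q \<in> V" for q
    using pp(1,2)[OF that] by (simp_all add: phi3_def phi4_def Phi_def n12)
  have sQ: "smooth_on V (\<lambda>q. \<Sum>\<alpha>\<in>UNIV. 2 * ((A \<alpha> q)\<^sup>2 + (B \<alpha> q)\<^sup>2))"
    by (intro smooth_on_sum smooth_on_mult smooth_on_add smooth_on_power2 smooth_on_const smooth_A smooth_B V)
  have lap: "laplacian c X (phi_norm_sq c X) u = frame_laplacian (\<lambda>q. \<Sum>\<alpha>\<in>UNIV. 2 * ((A \<alpha> q)\<^sup>2 + (B \<alpha> q)\<^sup>2)) u"
    using laplacian_cong_open[OF V u phi_norm_sq_eq] laplacian_frame[OF u sQ] by simp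
  have Hn: "mean_curvature c X u = p 1 u *\<^sub>R n 1 u"
    using pp(2)[OF u] by (simp add: mean_curvature_eq[OF u] sum_2)
  have \<nu>34: "prod_inner c xi (E3 c X u) = \<nu> 1 u" "prod_inner c xi (E4 u) = \<nu> 2 u"
    by (simp_all add: \<nu>_def n12 prod_inner_xi)
  have op: "op_norm_sq c X u (\<nu> 1 u *\<^sub>R phi3 c X u + \<nu> 2 u *\<^sub>R phi4 c X E4 u) =
      2 * ((\<Sum>\<alpha>\<in>UNIV. \<nu> \<alpha> u * A \<alpha> u)\<^sup>2 + (\<Sum>\<alpha>\<in>UNIV. \<nu> \<alpha> u * B \<alpha> u)\<^sup>2)"
    using op_norm_sq_Phi[OF u, of "\<lambda>\<alpha>. \<nu> \<alpha> u"] by (simp add: phi3[OF u] phi4[OF u] sum_2)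
  have HN: "prod_inner c (mean_curvature c X u) (nor_part c X u xi) = p 1 u * \<nu> 1 u"
    by (simp add: Hn nor_part_xi[OF u] prod_inner_simps orthonormal_n[OF u] mult_delta_right)
  have \<phi>H: "prod_inner c (\<Sum>i\<in>UNIV. \<Sum>j\<in>UNIV. (tan_coords c X u xi $ i * tan_coords c X u xi $ j) *\<^sub>R phi_form c X i j u)
      (mean_curvature c X u) = p 1 u * (A 1 u * ((T 1 u)\<^sup>2 - (T 2 u)\<^sup>2) + 2 * B 1 u * T 1 u * T 2 u)"
    unfolding phi_form_T[OF u] Hn by (simp add: prod_inner_simps orthonormal_n[OF u] mult_delta_right)
  have nab: "nabla_norm_sq c X (phi3 c X) u = 2 * ((dA 1 1 u)\<^sup>2 + (dA 1 2 u)\<^sup>2 + (dB 1 1 u)\<^sup>2 + (dB 1 2 u)\<^sup>2)"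
    "nabla_norm_sq c X (phi4 c X E4) u = 2 * ((dA 2 1 u)\<^sup>2 + (dA 2 2 u)\<^sup>2 + (dB 2 1 u)\<^sup>2 + (dB 2 2 u)\<^sup>2)"
    by (rule nabla_norm_sq_Phi[OF u phi3] nabla_norm_sq_Phi[OF u phi4]; assumption)+
  have eq1: "(1/2) * laplacian c X (phi_norm_sq c X) u =
      nabla_norm_sq c X (phi3 c X) u + nabla_norm_sq c X (phi4 c X E4) u - (phi_norm_sq c X u)\<^sup>2
      + (c * (2 - 3 * (prod_norm c (tan_part c X u xi))\<^sup>2) + 2 * (prod_norm c (mean_curvature c X u))\<^sup>2) * phi_norm_sq c X u
      - 2 * c * prod_inner c (\<Sum>i\<in>UNIV. \<Sum>j\<in>UNIV. (tan_coords c X u xi $ i * tan_coords c X u xi $ j) *\<^sub>R phi_form c X i j u)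
        (mean_curvature c X u)
      + 2 * c * op_norm_sq c X u (\<nu> 1 u *\<^sub>R phi3 c X u + \<nu> 2 u *\<^sub>R phi4 c X E4 u)"
    unfolding op \<phi>H lap nab tan_part_xi_norm[OF u]
      phi_norm_sq_eq[OF u] pp(1)[OF u, symmetric]
    using simons_frame[OF u pp(3)] pp(2)[OF u] by (simp add: sum_2)
  \<comment> \<open>\<open>A_N\<close> is \<open>nu_3 phi_3 + nu_4 phi_4\<close> plus
    \<open><H, N>\<close> times the identity, so its squared norm exceeds that of the traceless part
    by \<open>2 <H, N>^2\<close>; times \<open>2 c\<close> this is the subtracted
    \<open>4 c <H, N>^2\<close>.\<close>
  have eq2: "2 * c * op_norm_sq c X u (shape_op c X u (nor_part c X u xi))
      - 4 * c * (prod_inner c (mean_curvature c X u) (nor_part c X u xi))\<^sup>2 =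
      2 * c * op_norm_sq c X u (\<nu> 1 u *\<^sub>R phi3 c X u + \<nu> 2 u *\<^sub>R phi4 c X E4 u)"
    unfolding op HN unfolding nor_part_xi[OF u] op_norm_sq_shape_op[OF u]
    using pp(2)[OF u] by (simp add: sum_2 power2_eq_square algebra_simps)
  show ?thesis
    unfolding Let_def X_def[symmetric] \<nu>34 using eq1 eq2 by simp
qed

end
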